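(* Let $\nu\in\mathcal{M}(\Phi)$ and $\ell\in\mathbb{C}$. Then the function $$E(t,x):=\big(\mathbb{P}_t\nu(x)-\ell\big)-\mathbb{P}_t(\nu-\ell\,dy)(x),\qquad (t,x)\in(0,\infty)\times\mathbb{R}^d,$$ satisfies $$\lim_{(t,x)\to(0,x_0)}E(t,x)=0,\qquad\forall\,x_0\in\mathbb{R}^d,$$ where the limit is over $t>0$ and $x\in\mathbb{R}^d$.
   Context: Fix $d\ge1$. A locally finite complex measure in $\mathbb{R}^d$ is $\nu=\nu_1+i\nu_2$ where $\nu_1,\nu_2$ are signed Borel measures which are finite on compact sets; $|\nu|$ denotes its total variation (a positive Borel measure, finite on compact sets). $dy$ denotes Lebesgue measure and, for $\ell\in\mathbb{C}$, $\nu-\ell\,dy$ is the locally finite complex measure $E\mapsto\nu(E)-\ell|E|$ (for bounded Borel $E$, with $|E|$ the Lebesgue measure of $E$). Poisson–Hermite semigroup: let $L=-\Delta+|x|^2$ be the Hermite operator in $\mathbb{R}^d$ and $\mathbb{P}_t=e^{-t\sqrt L}=\frac{t}{\sqrt{4\pi}}\int_0^\infty e^{-t^2/(4\tau)}e^{-\tau L}\frac{d\tau}{\tau^{3/2}}$, $t>0$. Its integral kernel is $$\mathbb{P}_t(x,y)=c_d\,t\int_0^1\frac{e^{-t^2/\kappa(s)}(1-s^2)^{\frac d2-1}e^{-\frac14\left(\frac{|x-y|^2}{s}+s|x+y|^2\right)}}{s^{d/2}\,\kappa(s)^{3/2}}\,ds,\qquad \kappa(s)=2\ln\frac{1+s}{1-s},$$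 where $c_d=8(4\pi)^{-(d+1)/2}>0$. Let $\Phi(y)=\dfrac{e^{-|y|^2/2}}{(1+|y|)^{d/2}[\log(e+|y|)]^{3/2}}$, and let $\mathcal{M}(\Phi)$ be the set of locally finite complex measures $\nu$ in $\mathbb{R}^d$ with $\int_{\mathbb{R}^d}\Phi\,d|\nu|<\infty$. For $\nu\in\mathcal{M}(\Phi)$ set $\mathbb{P}_t\nu(x)=\int_{\mathbb{R}^d}\mathbb{P}_t(x,y)\,d\nu(y)$, which converges absolutely for all $t>0$, $x\in\mathbb{R}^d$. (Note $dy\in\mathcal M(\Phi)$.) *)

theory Defs
  imports "HOL-Analysis.Analysis"
begin

text \<open>
  Locally finite signed and complex measures are represented by their values on bounded Borel
  sets, because values on unbounded sets need not exist (\<open>\<infinity> - \<infinity>\<close>).  Values of the set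
  functions on all other sets are irrelevant.
\<close>

definition bounded_borel :: "'a::euclidean_space set set" where
  "bounded_borel = {E. E \<in> sets borel \<and> bounded E}"

definition locally_finite_signed_measure :: "('a::euclidean_space set \<Rightarrow> real) \<Rightarrow> bool" where
  "locally_finite_signed_measure \<mu> \<longleftrightarrow>
     (\<forall>A :: nat \<Rightarrow> 'a set.
        range A \<subseteq> sets borel \<longrightarrow> disjoint_family A \<longrightarrow> bounded (\<Union>i. A i) \<longrightarrow>
        (\<lambda>i. \<mu> (A i)) sums \<mu> (\<Union>i. A i))"

definition locally_finite_complex_measure :: "('a::euclidean_space set \<Rightarrow> complex) \<Rightarrow> bool" where
  "locally_finite_complex_measure \<nu> \<longleftrightarrow>
     locally_finite_signed_measure (\<lambda>E. Re (\<nu> E)) \<and>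
     locally_finite_signed_measure (\<lambda>E. Im (\<nu> E))"

text \<open>
  Total variation: the supremum of \<open>\<Sum>i. \<bar>\<nu>(A\<^sub>i)\<bar>\<close> over all countable Borel partitions of \<open>E\<close>
  into bounded pieces.  For a locally finite complex measure this set function is countably
  additive on all Borel sets, so it is the measure function of the result of
  \<open>measure_of\<close>.  The same applies to the positive variation below.
\<close>

definition total_variation :: "('a::euclidean_space set \<Rightarrow> complex) \<Rightarrow> 'a measure" where
  "total_variation \<nu> = measure_of UNIV (sets borel)
     (\<lambda>E. SUP A \<in> {A :: nat \<Rightarrow> 'a set. range A \<subseteq> bounded_borel \<and> disjoint_family A \<and> (\<Union>i. A i) = E}.
        \<Sum>i. ennreal (norm (\<nu> (A i))))"

text \<open>
  The Jordan decomposition of \<open>\<mu>\<close>: its positive part is \<open>positive_variation \<mu>\<close>, its negative part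
  is \<open>positive_variation (\<lambda>E. - \<mu> E)\<close>.
\<close>

definition positive_variation :: "('a::euclidean_space set \<Rightarrow> real) \<Rightarrow> 'a measure" where
  "positive_variation \<mu> = measure_of UNIV (sets borel)
     (\<lambda>E. SUP F \<in> {F. F \<in> bounded_borel \<and> F \<subseteq> E}. ennreal (\<mu> F))"

definition signed_integral :: "('a::euclidean_space set \<Rightarrow> real) \<Rightarrow> ('a \<Rightarrow> real) \<Rightarrow> real" where
  "signed_integral \<mu> f =
     (\<integral>y. f y \<partial>positive_variation \<mu>) - (\<integral>y. f y \<partial>positive_variation (\<lambda>E. - \<mu> E))"

definition complex_measure_integral ::
    "('a::euclidean_space set \<Rightarrow> complex) \<Rightarrow> ('a \<Rightarrow> real) \<Rightarrow> complex" where
  "complex_measure_integral \<nu> f =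
     Complex (signed_integral (\<lambda>E. Re (\<nu> E)) f) (signed_integral (\<lambda>E. Im (\<nu> E)) f)"

definition minus_lebesgue ::
    "('a::euclidean_space set \<Rightarrow> complex) \<Rightarrow> complex \<Rightarrow> 'a set \<Rightarrow> complex" where
  "minus_lebesgue \<nu> l = (\<lambda>E. \<nu> E - l * complex_of_real (measure lborel E))"

definition kappa :: "real \<Rightarrow> real" where
  "kappa s = 2 * ln ((1 + s) / (1 - s))"

text \<open>
  Integral kernel of \<open>exp (- t \<surd>L)\<close>, \<open>L = - \<Delta> + \<bar>x\<bar>\<^sup>2\<close>, obtained by subordination from the
  Mehler kernel of \<open>exp (- \<tau> L)\<close> with the substitution \<open>s = tanh \<tau>\<close>, so that \<open>kappa s = 4 \<tau>\<close>.
\<close>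

definition poisson_hermite_kernel :: "real \<Rightarrow> 'a::euclidean_space \<Rightarrow> 'a \<Rightarrow> real" where
  "poisson_hermite_kernel t x y =
     8 * (4 * pi) powr (- (real DIM('a) + 1) / 2) * t *
     (LINT s:{0<..<1}|lborel.
        exp (- t\<^sup>2 / kappa s) * (1 - s\<^sup>2) powr (real DIM('a) / 2 - 1) *
        exp (- (1 / 4) * ((norm (x - y))\<^sup>2 / s + s * (norm (x + y))\<^sup>2)) /
        (s powr (real DIM('a) / 2) * kappa s powr (3 / 2)))"

definition poisson_hermite ::
    "real \<Rightarrow> ('a::euclidean_space set \<Rightarrow> complex) \<Rightarrow> 'a \<Rightarrow> complex" where
  "poisson_hermite t \<nu> x = complex_measure_integral \<nu> (\<lambda>y. poisson_hermite_kernel t x y)"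

definition Phi :: "'a::euclidean_space \<Rightarrow> real" where
  "Phi y = exp (- (norm y)\<^sup>2 / 2) /
     ((1 + norm y) powr (real DIM('a) / 2) * ln (exp 1 + norm y) powr (3 / 2))"

definition measures_Phi :: "('a::euclidean_space set \<Rightarrow> complex) set" where
  "measures_Phi = {\<nu>. locally_finite_complex_measure \<nu> \<and>
     (\<integral>\<^sup>+ y. ennreal (Phi y) \<partial>total_variation \<nu>) < \<infinity>}"

end

theory Submission
  imports Defs "HOL-Probability.Distributions" "HOL-Real_Asymp.Real_Asymp"
begin

text \<open>
  By linearity the error \<open>E(t,x)\<close> equals \<open>l (P\<^sub>t 1(x) - 1)\<close>.  The claim thus amounts to the
  Poisson-Hermite semigroup, applied to the constant \<open>1\<close>, tending to \<open>1\<close> locally uniformly in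
  \<open>x\<close>.  Two things have to be shown.

  The first is the linearity.  Integrals against \<open>\<nu> - l dy\<close> are defined by the Jordan
  decompositions of its real and imaginary parts, which are not the decompositions of the parts of
  \<open>\<nu>\<close> shifted by Lebesgue measure.  The set functions defining the variations are shown to
  be measures (\<open>emeasure_positive_variation\<close>, \<open>emeasure_total_variation\<close>), and the Jordan identity
  is carried over from bounded sets to integrals in a form that contains only positive terms
  (\<open>signed_integral_minus_lebesgue\<close>).  All integrals must be finite for this, which is where
  \<open>Phi\<close> enters: for fixed \<open>t\<close> and \<open>x\<close> the kernel is at most a multiple of \<open>Phi\<close>
  (\<open>poisson_hermite_kernel_le_Phi\<close>).  In that estimate the factor \<open>exp (- \<bar>y\<bar>\<^sup>2 / 2)\<close> is the value of
  the Mehler exponential at \<open>s = 1\<close>; the distance \<open>\<delta> = 1 - s\<close> costs a further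
  \<open>exp (- c \<delta>\<^sup>2 \<bar>y\<bar>\<^sup>2)\<close>, so that only \<open>\<delta>\<close> of size \<open>1 / \<bar>y\<bar>\<close> matter.  For these, the powers of
  \<open>\<delta>\<close> and of \<open>kappa \<approx> - 2 ln \<delta>\<close> in the integrand produce the power and the logarithm in \<open>Phi\<close>.

  The second is the limit of \<open>P\<^sub>t 1(x)\<close>.  The kernel is an average of Mehler kernels against a
  probability density in \<open>s\<close>, which the substitution
  \<open>u = t / \<surd>(kappa s)\<close> turns into a Gaussian density on the half-line.  The
  integral of the Mehler kernel over \<open>y\<close> is explicit and differs from \<open>1\<close> by at most
  \<open>(2 d + \<bar>x\<bar>\<^sup>2) s\<close>.  For small \<open>t\<close> the density concentrates at \<open>s = 0\<close>, and integrating this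
  bound gives \<open>\<bar>P\<^sub>t 1(x) - 1\<bar> \<le> \<surd>\<pi> (2 + 2 d + \<bar>x\<bar>\<^sup>2) t\<close> (\<open>poisson_hermite_one\<close>).
\<close>

section \<open>Set functions that are superadditive and countably subadditive\<close>

text \<open>
  For set functions given as suprema, each of these two inequalities is natural: one chooses
  near-optimal competitors on two disjoint sets, or cuts one competitor into pieces.  Together they
  give countable additivity, even if the value \<open>\<infinity>\<close> occurs.
\<close>

lemma measure_of_borel_super_sub:
  fixes f :: "'a::euclidean_space set \<Rightarrow> ennreal"
  assumes empty: "f {} = 0"
    and super: "\<And>A B. A \<in> sets borel \<Longrightarrow> B \<in> sets borel \<Longrightarrow> A \<inter> B = {} \<Longrightarrow> f A + f B \<le> f (A \<union> B)"
    and sub: "\<And>A. range A \<subseteq> sets borel \<Longrightarrow> disjoint_family A \<Longrightarrow> f (\<Union>i::nat. A i) \<le> (\<Sum>i. f (A i))"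
    and E: "E \<in> sets borel"
  shows "emeasure (measure_of UNIV (sets borel) f) E = f E"
proof (rule emeasure_measure_of_sigma)
  show "sigma_algebra UNIV (sets (borel :: 'a measure))"
    using sets.sigma_algebra_axioms[of "borel :: 'a measure"] by simp
  show "positive (sets borel) f" using empty by (simp add: positive_def)
  show "E \<in> sets borel" by fact
  show "countably_additive (sets borel) f"
  proof (rule countably_additiveI)
    fix A :: "nat \<Rightarrow> 'a set"
    assume A: "range A \<subseteq> sets borel" and d: "disjoint_family A" and U: "(\<Union>i. A i) \<in> sets borel"
    have fin: "(\<Sum>i<n. f (A i)) \<le> f (\<Union>i<n. A i)" for n
    proof (induction n)
      case (Suc n)
      have "(\<Union>i<n. A i) \<inter> A n = {}"
      proof (rule equals0I)
        fix x assume "x \<in> (\<Union>i<n. A i) \<inter> A n"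
        then obtain i where "i < n" "x \<in> A i \<inter> A n" by auto
        then show False using disjoint_family_onD[OF d, of i n] by simp
      qed
      moreover have "(\<Union>i<n. A i) \<in> sets borel" "A n \<in> sets borel" using A by auto
      ultimately have "f (\<Union>i<n. A i) + f (A n) \<le> f ((\<Union>i<n. A i) \<union> A n)" by (intro super)
      moreover have "(\<Union>i<n. A i) \<union> A n = (\<Union>i<Suc n. A i)" by (auto simp: less_Suc_eq)
      ultimately show ?case using Suc by (simp, meson add_right_mono order_trans)
    qed (simp add: empty)
    have mono: "f (\<Union>i<n. A i) \<le> f (\<Union>i. A i)" for n
    proof -
      have B: "(\<Union>i<n. A i) \<in> sets borel" using A by auto
      have "f (\<Union>i<n. A i) \<le> f (\<Union>i<n. A i) + f ((\<Union>i. A i) - (\<Union>i<n. A i))" by simp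
      also have "\<dots> \<le> f ((\<Union>i<n. A i) \<union> ((\<Union>i. A i) - (\<Union>i<n. A i)))"
        using B U by (intro super sets.Diff) auto
      also have "(\<Union>i<n. A i) \<union> ((\<Union>i. A i) - (\<Union>i<n. A i)) = (\<Union>i. A i)" by auto
      finally show ?thesis .
    qed
    have "(\<Sum>i. f (A i)) \<le> f (\<Union>i. A i)"
      using order_trans[OF fin mono] by (intro suminf_le_const) auto
    with sub[OF A d] show "(\<Sum>i. f (A i)) = f (\<Union>i. A i)" by (rule antisym[rotated])
  qed
qed

lemma SUP_add_le_ennreal:
  fixes f g :: "_ \<Rightarrow> ennreal"
  assumes "I \<noteq> {}" "J \<noteq> {}" "\<And>i j. i \<in> I \<Longrightarrow> j \<in> J \<Longrightarrow> f i + g j \<le> c"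
  shows "(SUP i\<in>I. f i) + (SUP j\<in>J. g j) \<le> c"
  by (simp add: ennreal_SUP_add_left[OF assms(1), symmetric] ennreal_SUP_add_right[OF assms(2)]
      SUP_le_iff assms(3))

lemma bounded_borel_Int:
  "A \<in> bounded_borel \<Longrightarrow> B \<in> sets borel \<Longrightarrow> A \<inter> B \<in> bounded_borel"
  by (auto simp: bounded_borel_def intro: bounded_subset)

lemma bounded_borel_Diff:
  "A \<in> bounded_borel \<Longrightarrow> B \<in> sets borel \<Longrightarrow> A - B \<in> bounded_borel"
  by (auto simp: bounded_borel_def intro: bounded_subset)

lemma bounded_borel_Un:
  "A \<in> bounded_borel \<Longrightarrow> B \<in> bounded_borel \<Longrightarrow> A \<union> B \<in> bounded_borel"
  by (auto simp: bounded_borel_def)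

lemma bounded_borel_empty [simp]: "{} \<in> bounded_borel"
  by (simp add: bounded_borel_def)

lemma bounded_borel_sets: "A \<in> bounded_borel \<Longrightarrow> A \<in> sets borel"
  by (simp add: bounded_borel_def)

section \<open>Locally finite signed measures and their Jordan decomposition\<close>

lemma signed_sums:
  fixes \<mu> :: "'a::euclidean_space set \<Rightarrow> real"
  assumes "locally_finite_signed_measure \<mu>"
    and "range A \<subseteq> sets borel" "disjoint_family A" "bounded (\<Union>i. A i)"
  shows "(\<lambda>i. \<mu> (A i)) sums \<mu> (\<Union>i. A i)"
  using assms unfolding locally_finite_signed_measure_def by blast

lemma signed_empty:
  fixes \<mu> :: "'a::euclidean_space set \<Rightarrow> real"
  assumes "locally_finite_signed_measure \<mu>"
  shows "\<mu> {} = 0"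
proof -
  have "(\<lambda>i::nat. \<mu> {}) sums \<mu> {}"
    using signed_sums[OF assms, of "\<lambda>_. {}"] by (simp add: disjoint_family_on_def)
  then show ?thesis
    using sums_summable summable_const_iff by blast
qed

lemma signed_Un:
  fixes \<mu> :: "'a::euclidean_space set \<Rightarrow> real"
  assumes m: "locally_finite_signed_measure \<mu>"
    and A: "A \<in> bounded_borel" and B: "B \<in> bounded_borel" and AB: "A \<inter> B = {}"
  shows "\<mu> (A \<union> B) = \<mu> A + \<mu> B"
proof -
  have "(\<lambda>i. \<mu> (binaryset A B i)) sums \<mu> (\<Union>i. binaryset A B i)"
    using A B AB by (intro signed_sums[OF m])
      (auto simp: range_binaryset_eq UN_binaryset_eq bounded_borel_def disjoint_family_on_def binaryset_def)
  moreover have "(\<lambda>i. \<mu> (binaryset A B i)) sums (\<mu> A + \<mu> B)"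
    using signed_empty[OF m] by (rule binaryset_sums)
  ultimately show ?thesis by (simp add: UN_binaryset_eq sums_unique2)
qed

lemma signed_Diff:
  fixes \<mu> :: "'a::euclidean_space set \<Rightarrow> real"
  assumes "locally_finite_signed_measure \<mu>" "A \<in> bounded_borel" "B \<in> bounded_borel" "B \<subseteq> A"
  shows "\<mu> (A - B) = \<mu> A - \<mu> B"
proof -
  have "\<mu> (B \<union> (A - B)) = \<mu> B + \<mu> (A - B)"
    using assms by (intro signed_Un) (auto intro: bounded_borel_Diff bounded_borel_sets)
  moreover have "B \<union> (A - B) = A" using assms by auto
  ultimately show ?thesis by simp
qed

lemma signed_uminus:
  "locally_finite_signed_measure \<mu> \<Longrightarrow> locally_finite_signed_measure (\<lambda>E. - \<mu> E)"
  unfolding locally_finite_signed_measure_def using sums_minus by blast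

lemma sums_norm_le_suminf_ennreal:
  fixes f :: "nat \<Rightarrow> 'b::real_normed_vector"
  assumes "f sums s"
  shows "ennreal (norm s) \<le> (\<Sum>i. ennreal (norm (f i)))"
proof (rule LIMSEQ_le_const2)
  show "(\<lambda>n. ennreal (norm (\<Sum>i<n. f i))) \<longlonglongrightarrow> ennreal (norm s)"
    using assms by (intro tendsto_ennrealI tendsto_norm) (simp add: sums_def)
  have "ennreal (norm (\<Sum>i<n. f i)) \<le> (\<Sum>i. ennreal (norm (f i)))" for n
  proof -
    have "ennreal (norm (\<Sum>i<n. f i)) \<le> ennreal (\<Sum>i<n. norm (f i))"
      by (intro ennreal_leI norm_sum)
    also have "\<dots> = (\<Sum>i<n. ennreal (norm (f i)))" by simp
    also have "\<dots> \<le> (\<Sum>i. ennreal (norm (f i)))" by (intro sum_le_suminf) auto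
    finally show ?thesis .
  qed
  then show "\<exists>N. \<forall>n\<ge>N. ennreal (norm (\<Sum>i<n. f i)) \<le> (\<Sum>i. ennreal (norm (f i)))" by blast
qed

lemma sums_le_suminf_ennreal:
  fixes f :: "nat \<Rightarrow> real"
  assumes "f sums s"
  shows "ennreal s \<le> (\<Sum>i. ennreal (f i))"
proof (rule LIMSEQ_le_const2)
  show "(\<lambda>n. ennreal (\<Sum>i<n. f i)) \<longlonglongrightarrow> ennreal s"
    using assms by (intro tendsto_ennrealI) (simp add: sums_def)
  have "ennreal (\<Sum>i<n. f i) \<le> (\<Sum>i. ennreal (f i))" for n
  proof -
    have "ennreal (\<Sum>i<n. f i) \<le> ennreal (\<Sum>i<n. max 0 (f i))"
      by (intro ennreal_leI sum_mono) auto
    also have "\<dots> = (\<Sum>i<n. ennreal (max 0 (f i)))" by simp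
    also have "\<dots> = (\<Sum>i<n. ennreal (f i))" by (simp add: ennreal_max_0 max.commute)
    also have "\<dots> \<le> (\<Sum>i. ennreal (f i))" by (intro sum_le_suminf) auto
    finally show ?thesis .
  qed
  then show "\<exists>N. \<forall>n\<ge>N. ennreal (\<Sum>i<n. f i) \<le> (\<Sum>i. ennreal (f i))" by blast
qed

lemma sets_positive_variation [simp]: "sets (positive_variation \<mu>) = sets borel"
  using sets.sigma_sets_eq[of borel] by (simp add: positive_variation_def)

lemma space_positive_variation [simp]: "space (positive_variation \<mu>) = UNIV"
  by (simp add: positive_variation_def)

text \<open>
  Superadditivity holds because competitors in disjoint sets can be united, and subadditivity
  because \<open>\<mu> F\<close> is the sum of the \<open>\<mu> (F \<inter> A i)\<close>.
\<close>

lemma emeasure_positive_variation: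
  fixes \<mu> :: "'a::euclidean_space set \<Rightarrow> real"
  assumes m: "locally_finite_signed_measure \<mu>" and E: "E \<in> sets borel"
  shows "emeasure (positive_variation \<mu>) E = (SUP F \<in> {F. F \<in> bounded_borel \<and> F \<subseteq> E}. ennreal (\<mu> F))"
  unfolding positive_variation_def
proof (rule measure_of_borel_super_sub[OF _ _ _ E])
  let ?p = "\<lambda>E. SUP F \<in> {F. F \<in> bounded_borel \<and> F \<subseteq> E}. ennreal (\<mu> F)"
  have "{F. F \<in> bounded_borel \<and> F \<subseteq> ({}::'a set)} = {{}}" by auto
  then show "?p {} = 0" by (simp add: signed_empty[OF m])
  show "?p A + ?p B \<le> ?p (A \<union> B)" if "A \<inter> B = {}" for A B
  proof (rule SUP_add_le_ennreal)
    fix F G assume "F \<in> {F. F \<in> bounded_borel \<and> F \<subseteq> A}" "G \<in> {F. F \<in> bounded_borel \<and> F \<subseteq> B}"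
    then have F: "F \<in> bounded_borel" "F \<subseteq> A" and G: "G \<in> bounded_borel" "G \<subseteq> B" by auto
    have up: "ennreal (\<mu> H) \<le> ?p (A \<union> B)" if "H \<in> bounded_borel" "H \<subseteq> A \<union> B" for H
      using that by (intro SUP_upper) auto
    \<comment> \<open>A piece of negative measure contributes nothing and is left out of the union.\<close>
    show "ennreal (\<mu> F) + ennreal (\<mu> G) \<le> ?p (A \<union> B)"
    proof (cases "\<mu> F \<ge> 0 \<and> \<mu> G \<ge> 0")
      case True
      have "\<mu> (F \<union> G) = \<mu> F + \<mu> G" using F G that by (intro signed_Un[OF m]) auto
      with True have "ennreal (\<mu> F) + ennreal (\<mu> G) = ennreal (\<mu> (F \<union> G))" by simp
      also have "\<dots> \<le> ?p (A \<union> B)" using F G by (intro up bounded_borel_Un) auto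
      finally show ?thesis .
    next
      case False
      then show ?thesis using up[OF F(1)] up[OF G(1)] F G
        by (cases "\<mu> F \<ge> 0") (auto simp: ennreal_neg not_le le_supI1 le_supI2)
    qed
  qed (auto intro!: exI[of _ "{}"])
  show "?p (\<Union>i. A i) \<le> (\<Sum>i. ?p (A i))"
    if A: "range A \<subseteq> sets borel" "disjoint_family A" for A :: "nat \<Rightarrow> 'a set"
  proof (rule SUP_least, clarify)
    fix F assume F: "F \<in> bounded_borel" "F \<subseteq> (\<Union>i. A i)"
    have eq: "(\<Union>i. F \<inter> A i) = F" using F by auto
    have "(\<lambda>i. \<mu> (F \<inter> A i)) sums \<mu> (\<Union>i. F \<inter> A i)"
      using A F unfolding eq
      by (intro signed_sums[OF m, of "\<lambda>i. F \<inter> A i", unfolded eq])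
         (auto simp: bounded_borel_def disjoint_family_on_def)
    then have "ennreal (\<mu> F) \<le> (\<Sum>i. ennreal (\<mu> (F \<inter> A i)))"
      unfolding eq by (rule sums_le_suminf_ennreal)
    also have "\<dots> \<le> (\<Sum>i. ?p (A i))"
      using F A by (intro suminf_le allI SUP_upper) (auto intro: bounded_borel_Int)
    finally show "ennreal (\<mu> F) \<le> (\<Sum>i. ?p (A i))" .
  qed
qed

lemma le_positive_variation:
  fixes \<mu> :: "'a::euclidean_space set \<Rightarrow> real"
  assumes "locally_finite_signed_measure \<mu>" "E \<in> sets borel" "F \<in> bounded_borel" "F \<subseteq> E"
  shows "ennreal (\<mu> F) \<le> emeasure (positive_variation \<mu>) E"
  unfolding emeasure_positive_variation[OF assms(1,2)] using assms(3,4) by (intro SUP_upper) simp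

lemma positive_variation_le:
  fixes \<mu> :: "'a::euclidean_space set \<Rightarrow> real"
  assumes "locally_finite_signed_measure \<mu>" "E \<in> sets borel"
    and "\<And>F. F \<in> bounded_borel \<Longrightarrow> F \<subseteq> E \<Longrightarrow> ennreal (\<mu> F) \<le> c"
  shows "emeasure (positive_variation \<mu>) E \<le> c"
  unfolding emeasure_positive_variation[OF assms(1,2)] using assms(3) by (intro SUP_least) simp

text \<open>
  Passing to the complement in \<open>E\<close> turns subsets with large \<open>\<mu>\<close> into subsets with small
  \<open>\<mu>\<close>: \<open>\<mu> F = \<mu> E - \<mu> (E - F)\<close>, and the supremum over \<open>F\<close> gives
  \<open>positive part \<le> \<mu> E + negative part\<close>.
\<close>

lemma positive_variation_le_add:
  fixes \<mu> :: "'a::euclidean_space set \<Rightarrow> real"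
  assumes m: "locally_finite_signed_measure \<mu>" and E: "E \<in> bounded_borel"
    and fin: "emeasure (positive_variation (\<lambda>E. - \<mu> E)) E < \<infinity>"
  shows "emeasure (positive_variation \<mu>) E < \<infinity>"
    and "measure (positive_variation \<mu>) E \<le> \<mu> E + measure (positive_variation (\<lambda>E. - \<mu> E)) E"
proof -
  let ?N = "measure (positive_variation (\<lambda>E. - \<mu> E)) E"
  have N: "emeasure (positive_variation (\<lambda>E. - \<mu> E)) E = ennreal ?N"
    using fin by (intro emeasure_eq_ennreal_measure) auto
  have *: "\<mu> F \<le> \<mu> E + ?N" if F: "F \<in> bounded_borel" "F \<subseteq> E" for F
  proof -
    have "ennreal (- \<mu> (E - F)) \<le> ennreal ?N"
      unfolding N[symmetric] using E F
      by (intro le_positive_variation[OF signed_uminus[OF m]]) (auto intro: bounded_borel_Diff bounded_borel_sets)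
    then have "- \<mu> (E - F) \<le> ?N" by (subst (asm) ennreal_le_iff) auto
    then show ?thesis using signed_Diff[OF m E F] by simp
  qed
  have le: "emeasure (positive_variation \<mu>) E \<le> ennreal (\<mu> E + ?N)"
    using * E by (intro positive_variation_le[OF m]) (auto intro: bounded_borel_sets ennreal_leI)
  then show "emeasure (positive_variation \<mu>) E < \<infinity>"
    using ennreal_less_top le_less_trans by fastforce
  have "0 \<le> \<mu> E + ?N" using *[of "{}"] by (simp add: signed_empty[OF m])
  with le show "measure (positive_variation \<mu>) E \<le> \<mu> E + ?N"
    by (metis enn2real_ennreal enn2real_mono ennreal_less_top measure_def)
qed

text \<open>
  The inequality above, for \<open>\<mu>\<close> and for \<open>- \<mu>\<close>.  Finiteness of one variation is a hypothesis
  because below it is inherited from the total variation of \<open>\<nu>\<close>.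
\<close>

lemma jordan_decomposition:
  fixes \<mu> :: "'a::euclidean_space set \<Rightarrow> real"
  assumes m: "locally_finite_signed_measure \<mu>" and E: "E \<in> bounded_borel"
    and fin: "emeasure (positive_variation \<mu>) E < \<infinity>"
  shows "emeasure (positive_variation (\<lambda>E. - \<mu> E)) E < \<infinity>"
    and "\<mu> E = measure (positive_variation \<mu>) E - measure (positive_variation (\<lambda>E. - \<mu> E)) E"
proof -
  note a = positive_variation_le_add[OF signed_uminus[OF m] E, simplified, OF fin[unfolded infinity_ennreal_def]]
  show *: "emeasure (positive_variation (\<lambda>E. - \<mu> E)) E < \<infinity>" using a by simp
  from a positive_variation_le_add[OF m E *]
  show "\<mu> E = measure (positive_variation \<mu>) E - measure (positive_variation (\<lambda>E. - \<mu> E)) E" by simp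
qed

section \<open>Total variation\<close>

lemma sets_total_variation [simp]: "sets (total_variation \<nu>) = sets borel"
  using sets.sigma_sets_eq[of borel] by (simp add: total_variation_def)

lemma space_total_variation [simp]: "space (total_variation \<nu>) = UNIV"
  by (simp add: total_variation_def)

lemma complex_sums:
  fixes \<nu> :: "'a::euclidean_space set \<Rightarrow> complex"
  assumes "locally_finite_complex_measure \<nu>"
    and "range A \<subseteq> sets borel" "disjoint_family A" "bounded (\<Union>i. A i)"
  shows "(\<lambda>i. \<nu> (A i)) sums \<nu> (\<Union>i. A i)"
  using assms signed_sums[of "\<lambda>E. Re (\<nu> E)" A] signed_sums[of "\<lambda>E. Im (\<nu> E)" A]
  by (simp add: locally_finite_complex_measure_def sums_complex_iff)

lemma ex_bounded_partition:
  fixes E :: "'a::euclidean_space set"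
  assumes "E \<in> sets borel"
  shows "\<exists>A :: nat \<Rightarrow> 'a set. range A \<subseteq> bounded_borel \<and> disjoint_family A \<and> (\<Union>i. A i) = E"
proof (intro exI conjI)
  let ?B = "\<lambda>n. ball (0::'a) (real n)"
  have sub: "disjointed ?B n \<subseteq> ?B n" for n by (rule disjointed_subset)
  have U: "(\<Union>n. ?B n) = UNIV"
    using reals_Archimedean2 by auto
  show "range (\<lambda>n. disjointed ?B n \<inter> E) \<subseteq> bounded_borel"
    using assms bounded_subset[OF bounded_ball sub]
    by (auto simp: disjointed_def bounded_borel_def intro: bounded_subset bounded_ball)
  show "disjoint_family (\<lambda>n. disjointed ?B n \<inter> E)"
    using disjoint_family_disjointed[of ?B] by (auto simp: disjoint_family_on_def)
  show "(\<Union>n. disjointed ?B n \<inter> E) = E"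
    using UN_disjointed_eq[of ?B] U by auto
qed

lemma suminf_swap_ennreal:
  fixes f :: "nat \<Rightarrow> nat \<Rightarrow> ennreal"
  shows "(\<Sum>i. \<Sum>j. f i j) = (\<Sum>j. \<Sum>i. f i j)"
proof -
  have "(\<Sum>i. \<Sum>j. f i j) = (\<Sum>i. \<integral>\<^sup>+j. f i j \<partial>count_space UNIV)"
    by (simp add: nn_integral_count_space_nat)
  also have "\<dots> = (\<integral>\<^sup>+j. (\<Sum>i. f i j) \<partial>count_space UNIV)"
    by (rule nn_integral_suminf[symmetric]) auto
  finally show ?thesis by (simp add: nn_integral_count_space_nat)
qed

text \<open>
  Partitions of two disjoint sets interleave to a partition of the union, and a partition of
  \<open>\<Union>i. A i\<close> is refined by intersecting it with the \<open>A i\<close>, which can only increase the sum of the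
  norms.
\<close>

lemma emeasure_total_variation:
  fixes \<nu> :: "'a::euclidean_space set \<Rightarrow> complex"
  assumes m: "locally_finite_complex_measure \<nu>" and E: "E \<in> sets borel"
  shows "emeasure (total_variation \<nu>) E =
    (SUP A \<in> {A :: nat \<Rightarrow> 'a set. range A \<subseteq> bounded_borel \<and> disjoint_family A \<and> (\<Union>i. A i) = E}.
        \<Sum>i. ennreal (norm (\<nu> (A i))))"
  unfolding total_variation_def
proof (rule measure_of_borel_super_sub[OF _ _ _ E])
  let ?S = "\<lambda>E. {A :: nat \<Rightarrow> 'a set. range A \<subseteq> bounded_borel \<and> disjoint_family A \<and> (\<Union>i. A i) = E}"
  let ?s = "\<lambda>A. \<Sum>i::nat. ennreal (norm (\<nu> (A i)))"
  let ?p = "\<lambda>E. SUP A \<in> ?S E. ?s A"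
  have ne: "?S E \<noteq> {}" if "E \<in> sets borel" for E using ex_bounded_partition[OF that] by blast
  have e: "\<nu> {} = 0"
    using m signed_empty[of "\<lambda>E. Re (\<nu> E)"] signed_empty[of "\<lambda>E. Im (\<nu> E)"]
    by (simp add: locally_finite_complex_measure_def complex_eq_iff)
  have "?p {} \<le> 0" by (rule SUP_least) (auto simp: e)
  then show "?p {} = 0" by simp
  show "?p A + ?p B \<le> ?p (A \<union> B)" if AB: "A \<in> sets borel" "B \<in> sets borel" "A \<inter> B = {}" for A B
  proof (rule SUP_add_le_ennreal[OF ne[OF AB(1)] ne[OF AB(2)]])
    fix a b assume a: "a \<in> ?S A" and b: "b \<in> ?S B"
    \<comment> \<open>Interleave the two partitions.\<close>
    define c where "c k = (if even k then a (k div 2) else b (k div 2))" for k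
    have "range c \<subseteq> bounded_borel" using a b by (auto simp: c_def)
    moreover have "disjoint_family c"
      unfolding disjoint_family_on_def
    proof (intro ballI impI)
      fix i j :: nat assume "i \<noteq> j"
      have 1: "a k \<inter> b k' = {}" for k k' using a b AB(3) by blast
      have 2: "a k \<inter> a k' = {}" "b k \<inter> b k' = {}" if "k \<noteq> k'" for k k'
        using a b that by (auto simp: disjoint_family_on_def)
      have 3: "i div 2 \<noteq> j div 2" if "even i = even j"
        using that \<open>i \<noteq> j\<close> by presburger
      show "c i \<inter> c j = {}" using 1 2 3 unfolding c_def by (auto simp: Int_commute)
    qed
    moreover have "(\<Union>k. c k) = A \<union> B"
    proof -
      have "c (2 * k) = a k" "c (2 * k + 1) = b k" for k by (auto simp: c_def)
      then have "(\<Union>k. a k) \<union> (\<Union>k. b k) \<subseteq> (\<Union>k. c k)" by blast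
      moreover have "(\<Union>k. c k) \<subseteq> (\<Union>k. a k) \<union> (\<Union>k. b k)" by (auto simp: c_def split: if_splits)
      ultimately show ?thesis using a b by auto
    qed
    ultimately have c: "c \<in> ?S (A \<union> B)" by simp
    have "(\<Sum>k<n. ennreal (norm (\<nu> (a k)))) + (\<Sum>k<n. ennreal (norm (\<nu> (b k)))) =
        (\<Sum>k<2*n. ennreal (norm (\<nu> (c k))))" for n
      by (induction n) (auto simp: c_def ac_simps)
    also have "(\<Sum>k<2*n. ennreal (norm (\<nu> (c k)))) \<le> ?s c" for n
      by (intro sum_le_suminf) auto
    finally have le: "(\<Sum>k<n. ennreal (norm (\<nu> (a k)))) + (\<Sum>k<n. ennreal (norm (\<nu> (b k)))) \<le> ?s c" for n .
    have "(\<lambda>n. (\<Sum>k<n. ennreal (norm (\<nu> (a k)))) + (\<Sum>k<n. ennreal (norm (\<nu> (b k)))))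
        \<longlonglongrightarrow> ?s a + ?s b"
      by (intro tendsto_add summable_LIMSEQ) auto
    then have "?s a + ?s b \<le> ?s c" using le by (intro LIMSEQ_le_const2) auto
    also have "\<dots> \<le> ?p (A \<union> B)" using c by (rule SUP_upper)
    finally show "?s a + ?s b \<le> ?p (A \<union> B)" .
  qed
  show "?p (\<Union>i. A i) \<le> (\<Sum>i. ?p (A i))"
    if A: "range A \<subseteq> sets borel" "disjoint_family A" for A :: "nat \<Rightarrow> 'a set"
  proof (rule SUP_least)
    fix a assume a: "a \<in> ?S (\<Union>i. A i)"
    have "ennreal (norm (\<nu> (a j))) \<le> (\<Sum>i. ennreal (norm (\<nu> (a j \<inter> A i))))" for j
    proof (rule sums_norm_le_suminf_ennreal)
      have eq: "(\<Union>i. a j \<inter> A i) = a j" using a by auto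
      have aj: "a j \<in> bounded_borel" using a by auto
      show "(\<lambda>i. \<nu> (a j \<inter> A i)) sums \<nu> (a j)"
        using aj A by (intro complex_sums[OF m, of "\<lambda>i. a j \<inter> A i", unfolded eq])
          (auto simp: bounded_borel_def disjoint_family_on_def)
    qed
    then have "?s a \<le> (\<Sum>j. \<Sum>i. ennreal (norm (\<nu> (a j \<inter> A i))))"
      by (intro suminf_le) auto
    also have "\<dots> = (\<Sum>i. ?s (\<lambda>j. a j \<inter> A i))" by (rule suminf_swap_ennreal)
    also have "\<dots> \<le> (\<Sum>i. ?p (A i))"
    proof (intro suminf_le allI SUP_upper)
      fix i
      have "A i \<in> sets borel" using A by auto
      then have "range (\<lambda>j. a j \<inter> A i) \<subseteq> bounded_borel"
        using a by (auto intro!: bounded_borel_Int)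
      then show "(\<lambda>j. a j \<inter> A i) \<in> ?S (A i)"
        using a unfolding disjoint_family_on_def by blast
    qed auto
    finally show "?s a \<le> (\<Sum>i. ?p (A i))" .
  qed
qed

lemma norm_le_total_variation:
  fixes \<nu> :: "'a::euclidean_space set \<Rightarrow> complex"
  assumes m: "locally_finite_complex_measure \<nu>" and E: "E \<in> sets borel"
    and F: "F \<in> bounded_borel" "F \<subseteq> E"
  shows "ennreal (norm (\<nu> F)) \<le> emeasure (total_variation \<nu>) E"
proof -
  let ?a = "\<lambda>i::nat. if i = 0 then F else {}"
  have "ennreal (norm (\<nu> F)) = (\<Sum>i\<in>{0}. ennreal (norm (\<nu> (?a i))))" by simp
  also have "\<dots> \<le> (\<Sum>i. ennreal (norm (\<nu> (?a i))))" by (intro sum_le_suminf) auto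
  also have "\<dots> \<le> emeasure (total_variation \<nu>) F"
    unfolding emeasure_total_variation[OF m bounded_borel_sets[OF F(1)]]
    using F by (intro SUP_upper) (auto simp: disjoint_family_on_def split: if_splits)
  also have "\<dots> \<le> emeasure (total_variation \<nu>) E"
    using F E by (intro emeasure_mono) auto
  finally show ?thesis .
qed

section \<open>Comparing integrals of families of measures\<close>

text \<open>
  Finite families stand for sums of measures, so that an identity between signed measures can be
  used after moving the negative terms to the other side.  It is enough to test bounded sets because
  a Borel set is the increasing union of its intersections with balls.
\<close>

lemma nn_integral_sum_mono_of_bounded_borel:
  fixes M :: "'i \<Rightarrow> 'a::euclidean_space measure" and N :: "'j \<Rightarrow> 'a measure"
  assumes sets: "\<And>i. i \<in> I \<Longrightarrow> sets (M i) = sets borel" "\<And>j. j \<in> J \<Longrightarrow> sets (N j) = sets borel"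
    and le: "\<And>E. E \<in> bounded_borel \<Longrightarrow> (\<Sum>i\<in>I. emeasure (M i) E) \<le> (\<Sum>j\<in>J. emeasure (N j) E)"
    and f: "f \<in> borel_measurable borel"
  shows "(\<Sum>i\<in>I. \<integral>\<^sup>+x. f x \<partial>M i) \<le> (\<Sum>j\<in>J. \<integral>\<^sup>+x. f x \<partial>N j)"
proof -
  have meas: "g \<in> borel_measurable K" if "sets K = sets borel" "g \<in> borel_measurable borel"
    for g :: "'a \<Rightarrow> ennreal" and K :: "'a measure"
    using that measurable_cong_sets by blast
  show ?thesis using f
  proof (induction f rule: borel_measurable_induct)
    case (cong f g)
    have "(\<Sum>i\<in>I. \<integral>\<^sup>+x. f x \<partial>M i) = (\<Sum>i\<in>I. \<integral>\<^sup>+x. g x \<partial>M i)"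
      using cong by (intro sum.cong nn_integral_cong) auto
    moreover have "(\<Sum>i\<in>J. \<integral>\<^sup>+x. f x \<partial>N i) = (\<Sum>i\<in>J. \<integral>\<^sup>+x. g x \<partial>N i)"
      using cong by (intro sum.cong nn_integral_cong) auto
    ultimately show ?case using cong by simp
  next
    case (set A)
    let ?A = "\<lambda>n. A \<inter> ball 0 (real n)"
    have U: "(\<Union>n. ?A n) = A"
      using reals_Archimedean2 by auto
    have inc: "incseq ?A" by (auto simp: incseq_def)
    have lim: "(SUP n. emeasure K (?A n)) = emeasure K A" if "sets K = sets borel" for K :: "'a measure"
    proof -
      have "range ?A \<subseteq> sets K" unfolding that using set by auto
      from SUP_emeasure_incseq[OF this inc] show ?thesis unfolding U .
    qed
    have incK: "incseq (\<lambda>n. emeasure K (?A n))" if "sets K = sets borel" for K :: "'a measure"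
    proof (rule monoI)
      fix m n :: nat assume "m \<le> n"
      then show "emeasure K (?A m) \<le> emeasure K (?A n)"
        using set inc by (intro emeasure_mono) (auto simp: incseq_def that)
    qed
    have "(SUP n. \<Sum>i\<in>I. emeasure (M i) (?A n)) \<le> (SUP n. \<Sum>j\<in>J. emeasure (N j) (?A n))"
      using set by (intro SUP_mono' le) (auto simp: bounded_borel_def intro: bounded_subset[OF bounded_ball])
    also have "(SUP n. \<Sum>i\<in>I. emeasure (M i) (?A n)) = (\<Sum>i\<in>I. emeasure (M i) A)"
      by (subst ennreal_SUP_sum) (auto simp only: incK lim sets intro!: sum.cong)
    also have "(SUP n. \<Sum>i\<in>J. emeasure (N i) (?A n)) = (\<Sum>i\<in>J. emeasure (N i) A)"
      by (subst ennreal_SUP_sum) (auto simp only: incK lim sets intro!: sum.cong)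
    also have "(\<Sum>i\<in>I. emeasure (M i) A) = (\<Sum>i\<in>I. \<integral>\<^sup>+x. indicator A x \<partial>M i)"
      using set sets(1) by (intro sum.cong refl nn_integral_indicator[symmetric]) blast
    also have "(\<Sum>i\<in>J. emeasure (N i) A) = (\<Sum>i\<in>J. \<integral>\<^sup>+x. indicator A x \<partial>N i)"
      using set sets(2) by (intro sum.cong refl nn_integral_indicator[symmetric]) blast
    finally show ?case .
  next
    case (mult u c)
    have "(\<Sum>i\<in>I. \<integral>\<^sup>+x. c * u x \<partial>M i) = c * (\<Sum>i\<in>I. \<integral>\<^sup>+x. u x \<partial>M i)"
      unfolding sum_distrib_left using mult by (auto intro!: sum.cong nn_integral_cmult meas[OF sets(1)])
    moreover have "(\<Sum>i\<in>J. \<integral>\<^sup>+x. c * u x \<partial>N i) = c * (\<Sum>i\<in>J. \<integral>\<^sup>+x. u x \<partial>N i)"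
      unfolding sum_distrib_left using mult by (auto intro!: sum.cong nn_integral_cmult meas[OF sets(2)])
    ultimately show ?case using mult by (simp add: mult_left_mono)
  next
    case (add u v)
    have "(\<Sum>i\<in>I. \<integral>\<^sup>+x. v x + u x \<partial>M i) = (\<Sum>i\<in>I. \<integral>\<^sup>+x. v x \<partial>M i) + (\<Sum>i\<in>I. \<integral>\<^sup>+x. u x \<partial>M i)"
      unfolding sum.distrib[symmetric] using add by (auto intro!: sum.cong nn_integral_add meas[OF sets(1)])
    moreover have "(\<Sum>i\<in>J. \<integral>\<^sup>+x. v x + u x \<partial>N i) = (\<Sum>i\<in>J. \<integral>\<^sup>+x. v x \<partial>N i) + (\<Sum>i\<in>J. \<integral>\<^sup>+x. u x \<partial>N i)"
      unfolding sum.distrib[symmetric] using add by (auto intro!: sum.cong nn_integral_add meas[OF sets(2)])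
    ultimately show ?case using add by (simp add: add_mono)
  next
    case (seq U)
    have lim: "(\<integral>\<^sup>+x. (SUP n. U n) x \<partial>K) = (SUP n. \<integral>\<^sup>+x. U n x \<partial>K)" if "sets K = sets borel" for K :: "'a measure"
      unfolding SUP_apply using seq that
      by (auto intro!: nn_integral_monotone_convergence_SUP meas[OF that])
    have incK: "incseq (\<lambda>n. \<integral>\<^sup>+x. U n x \<partial>K)" for K :: "'a measure"
      using seq by (auto simp: incseq_def le_fun_def intro!: nn_integral_mono)
    have "(SUP n. \<Sum>i\<in>I. \<integral>\<^sup>+x. U n x \<partial>M i) \<le> (SUP n. \<Sum>j\<in>J. \<integral>\<^sup>+x. U n x \<partial>N j)"
      using seq by (intro SUP_mono') auto
    also have "(SUP n. \<Sum>i\<in>I. \<integral>\<^sup>+x. U n x \<partial>M i) = (\<Sum>i\<in>I. \<integral>\<^sup>+x. (SUP n. U n) x \<partial>M i)"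
      by (subst ennreal_SUP_sum) (auto simp only: incK lim sets intro!: sum.cong)
    also have "(SUP n. \<Sum>i\<in>J. \<integral>\<^sup>+x. U n x \<partial>N i) = (\<Sum>i\<in>J. \<integral>\<^sup>+x. (SUP n. U n) x \<partial>N i)"
      by (subst ennreal_SUP_sum) (auto simp only: incK lim sets intro!: sum.cong)
    finally show ?case .
  qed
qed

section \<open>Subtracting a multiple of Lebesgue measure\<close>

lemma signed_minus_lebesgue:
  fixes \<mu> :: "'a::euclidean_space set \<Rightarrow> real"
  assumes m: "locally_finite_signed_measure \<mu>"
  shows "locally_finite_signed_measure (\<lambda>E. \<mu> E - c * measure lborel E)"
  unfolding locally_finite_signed_measure_def
proof (intro allI impI sums_diff sums_mult)
  fix A :: "nat \<Rightarrow> 'a set"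
  assume A: "range A \<subseteq> sets borel" "disjoint_family A" "bounded (\<Union>i. A i)"
  show "(\<lambda>i. \<mu> (A i)) sums \<mu> (\<Union>i. A i)" by (rule signed_sums[OF m A])
  have "emeasure lborel (\<Union>i. A i) < \<infinity>" using A(3) by (rule emeasure_bounded_finite)
  then show "(\<lambda>i. measure lborel (A i)) sums measure lborel (\<Union>i. A i)"
    using A by (intro measure_UNION) auto
qed

lemma emeasure_lborel_bounded_borel:
  fixes E :: "'a::euclidean_space set"
  assumes "E \<in> bounded_borel"
  shows "emeasure lborel E < top"
  using assms emeasure_bounded_finite[of E] by (simp add: bounded_borel_def)

lemma ennreal_max_zero: "ennreal (max 0 c) = ennreal c"
  by (simp add: max_def ennreal_neg)

lemma ennreal_add_le: "ennreal (a + b) \<le> ennreal a + ennreal b"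
proof (cases "a \<ge> 0 \<and> b \<ge> 0")
  case False
  then have "ennreal (a + b) \<le> ennreal (max a b)" by (intro ennreal_leI) auto
  also have "\<dots> \<le> ennreal a + ennreal b" by (auto simp: max_def)
  finally show ?thesis .
qed simp

lemma positive_variation_minus_lebesgue_le:
  fixes \<mu> :: "'a::euclidean_space set \<Rightarrow> real"
  assumes m: "locally_finite_signed_measure \<mu>" and E: "E \<in> bounded_borel"
  shows "emeasure (positive_variation (\<lambda>E. \<mu> E - c * measure lborel E)) E \<le>
    emeasure (positive_variation \<mu>) E + ennreal (- c) * emeasure lborel E"
proof (rule positive_variation_le[OF signed_minus_lebesgue[OF m] bounded_borel_sets[OF E]])
  fix F assume F: "F \<in> bounded_borel" "F \<subseteq> E"
  have FE: "measure lborel F \<le> measure lborel E"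
    using E F by (intro measure_mono_fmeasurable fmeasurableI)
      (auto simp: emeasure_lborel_bounded_borel bounded_borel_sets)
  have "ennreal (\<mu> F - c * measure lborel F) \<le> ennreal (\<mu> F) + ennreal (- c * measure lborel F)"
    using ennreal_add_le[of "\<mu> F" "- c * measure lborel F"] by simp
  also have "\<dots> \<le> ennreal (\<mu> F) + ennreal (- c) * ennreal (measure lborel E)"
    using FE by (cases "c \<le> 0")
      (auto simp: ennreal_mult[symmetric] ennreal_neg mult_left_mono_neg intro!: ennreal_leI add_left_mono)
  also have "ennreal (measure lborel E) = emeasure lborel E"
    using emeasure_lborel_bounded_borel[OF E] by (intro emeasure_eq_ennreal_measure[symmetric]) auto
  also have "ennreal (\<mu> F) \<le> emeasure (positive_variation \<mu>) E"
    using E F by (intro le_positive_variation[OF m] bounded_borel_sets)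
  finally show "ennreal (\<mu> F - c * measure lborel F) \<le>
    emeasure (positive_variation \<mu>) E + ennreal (- c) * emeasure lborel E"
    by (simp add: add_right_mono)
qed

lemma enn2real_nn_integral_nonneg:
  fixes f :: "'b \<Rightarrow> real"
  assumes "f \<in> borel_measurable M" "\<And>y. 0 \<le> f y"
  shows "(\<integral>y. f y \<partial>M) = enn2real (\<integral>\<^sup>+y. f y \<partial>M)"
  using assms by (intro integral_eq_nn_integral) auto

text \<open>
  The positive and negative parts of \<open>\<mu> - c dy\<close> are not those of \<open>\<mu>\<close> corrected by Lebesgue
  measure, because of cancellation.  But the identity \<open>P' - N' = P - N - c dy\<close>, rearranged so
  that only positive terms occur, holds on bounded sets and therefore for integrals.
\<close>

lemma signed_integral_minus_lebesgue:
  fixes \<mu> :: "'a::euclidean_space set \<Rightarrow> real" and f :: "'a \<Rightarrow> real"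
  assumes m: "locally_finite_signed_measure \<mu>"
    and fin: "\<And>E. E \<in> bounded_borel \<Longrightarrow> emeasure (positive_variation \<mu>) E < \<infinity>"
    and f: "f \<in> borel_measurable borel" "\<And>y. 0 \<le> f y"
    and fP: "(\<integral>\<^sup>+y. f y \<partial>positive_variation \<mu>) < \<infinity>"
    and fN: "(\<integral>\<^sup>+y. f y \<partial>positive_variation (\<lambda>E. - \<mu> E)) < \<infinity>"
    and fL: "(\<integral>\<^sup>+y. f y \<partial>lborel) < \<infinity>"
  shows "signed_integral (\<lambda>E. \<mu> E - c * measure lborel E) f =
    signed_integral \<mu> f - c * (\<integral>y. f y \<partial>lborel)"
proof -
  define \<mu>' where "\<mu>' = (\<lambda>E::'a set. \<mu> E - c * measure lborel E)"
  define P where "P = positive_variation \<mu>"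
  define N where "N = positive_variation (\<lambda>E. - \<mu> E)"
  define P' where "P' = positive_variation \<mu>'"
  define N' where "N' = positive_variation (\<lambda>E. - \<mu>' E)"
  define U where "U = scale_measure (ennreal c) (lborel :: 'a measure)"
  define D where "D = scale_measure (ennreal (- c)) (lborel :: 'a measure)"
  note defs = P_def N_def P'_def N'_def U_def D_def
  have m': "locally_finite_signed_measure \<mu>'" unfolding \<mu>'_def by (rule signed_minus_lebesgue[OF m])
  have N'_alt: "N' = positive_variation (\<lambda>E. - \<mu> E - (- c) * measure lborel E)"
    by (simp add: N'_def \<mu>'_def algebra_simps)
  have sets [simp]: "sets P = sets borel" "sets N = sets borel" "sets P' = sets borel"
    "sets N' = sets borel" "sets U = sets borel" "sets D = sets borel"
    by (simp_all add: defs)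
  have leP: "emeasure P' E \<le> emeasure P E + emeasure D E" if "E \<in> bounded_borel" for E
    using positive_variation_minus_lebesgue_le[OF m that, of c] by (simp add: defs \<mu>'_def)
  have leN: "emeasure N' E \<le> emeasure N E + emeasure U E" if "E \<in> bounded_borel" for E
    using positive_variation_minus_lebesgue_le[OF signed_uminus[OF m] that, of "- c"]
    by (simp add: N'_alt defs)
  have finite: "emeasure P E < \<infinity>" "emeasure N E < \<infinity>" "emeasure P' E < \<infinity>" "emeasure N' E < \<infinity>"
    and L: "emeasure lborel E < \<infinity>"
    and P: "\<mu> E = measure P E - measure N E" and P': "\<mu>' E = measure P' E - measure N' E"
    if E: "E \<in> bounded_borel" for E
  proof -
    show 1: "emeasure P E < \<infinity>" unfolding P_def by (rule fin[OF E])
    show "emeasure N E < \<infinity>" "\<mu> E = measure P E - measure N E"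
      using jordan_decomposition[OF m E fin[OF E]] by (simp_all add: defs)
    show 2: "emeasure lborel E < \<infinity>"
      using E by (simp add: emeasure_lborel_bounded_borel)
    have "emeasure P E + emeasure D E < \<infinity>" using 1 2 by (simp add: D_def ennreal_mult_less_top)
    with leP[OF E] show 3: "emeasure P' E < \<infinity>" by (rule le_less_trans)
    show "emeasure N' E < \<infinity>" "\<mu>' E = measure P' E - measure N' E"
      using jordan_decomposition[OF m' E] 3 by (simp_all add: defs)
  qed
  define M where "M i = (if i = 0 then P' else if i = 1 then N else U)" for i :: nat
  define K where "K i = (if i = 0 then N' else if i = 1 then P else D)" for i :: nat
  have setsMK: "sets (M i) = sets borel" "sets (K i) = sets borel" for i
    by (auto simp: M_def K_def)
  have eq: "(\<Sum>i<3. emeasure (M i) E) = (\<Sum>i<3. emeasure (K i) E)" if E: "E \<in> bounded_borel" for E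
  proof -
    let ?l = "measure lborel E"
    have em: "emeasure X E = ennreal (measure X E)" if "emeasure X E < \<infinity>" for X
      using that by (intro emeasure_eq_ennreal_measure) auto
    have "\<mu>' E = \<mu> E - c * ?l" by (simp add: \<mu>'_def)
    then have "measure P' E + measure N E + max 0 c * ?l = measure N' E + measure P E + max 0 (- c) * ?l"
      using P[OF E] P'[OF E] by (cases "c \<ge> 0") auto
    then have "ennreal (measure P' E) + ennreal (measure N E) + ennreal (max 0 c * ?l) =
        ennreal (measure N' E) + ennreal (measure P E) + ennreal (max 0 (- c) * ?l)"
      by (simp flip: ennreal_plus)
    moreover have "emeasure U E = ennreal (max 0 c * ?l)" "emeasure D E = ennreal (max 0 (- c) * ?l)"
      by (simp_all add: U_def D_def em[OF L[OF E]] ennreal_mult ennreal_max_zero)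
    ultimately show ?thesis
      by (simp add: M_def K_def eval_nat_numeral em[OF finite(1)[OF E]] em[OF finite(2)[OF E]]
          em[OF finite(3)[OF E]] em[OF finite(4)[OF E]])
  qed
  have fm: "(\<lambda>y. ennreal (f y)) \<in> borel_measurable borel" using f by measurable
  have "(\<Sum>i<3. \<integral>\<^sup>+y. f y \<partial>M i) = (\<Sum>i<3. \<integral>\<^sup>+y. f y \<partial>K i)"
    using eq by (intro antisym nn_integral_sum_mono_of_bounded_borel[OF setsMK(1) setsMK(2) _ fm]
        nn_integral_sum_mono_of_bounded_borel[OF setsMK(2) setsMK(1) _ fm]) auto
  then have *: "(\<integral>\<^sup>+y. f y \<partial>P') + (\<integral>\<^sup>+y. f y \<partial>N) + (\<integral>\<^sup>+y. f y \<partial>U) =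
      (\<integral>\<^sup>+y. f y \<partial>N') + (\<integral>\<^sup>+y. f y \<partial>P) + (\<integral>\<^sup>+y. f y \<partial>D)"
    by (simp add: M_def K_def eval_nat_numeral)
  have mono: "(\<integral>\<^sup>+y. f y \<partial>X) \<le> (\<integral>\<^sup>+y. f y \<partial>Y) + (\<integral>\<^sup>+y. f y \<partial>Z)"
    if "\<And>E. E \<in> bounded_borel \<Longrightarrow> emeasure X E \<le> emeasure Y E + emeasure Z E"
      and "sets X = sets borel" "sets Y = sets borel" "sets Z = sets borel" for X Y Z :: "'a measure"
    using nn_integral_sum_mono_of_bounded_borel[of "{0::nat}" "\<lambda>_. X" "{..<2::nat}" "\<lambda>i. if i = 0 then Y else Z", OF _ _ _ fm]
      that by (simp add: eval_nat_numeral)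
  have fUD: "(\<integral>\<^sup>+y. f y \<partial>U) = ennreal (max 0 c) * (\<integral>\<^sup>+y. f y \<partial>lborel)"
    "(\<integral>\<^sup>+y. f y \<partial>D) = ennreal (max 0 (- c)) * (\<integral>\<^sup>+y. f y \<partial>lborel)"
    using fm by (simp_all add: U_def D_def nn_integral_scale_measure ennreal_max_zero)
  have fUD_fin: "(\<integral>\<^sup>+y. f y \<partial>U) < \<infinity>" "(\<integral>\<^sup>+y. f y \<partial>D) < \<infinity>"
    using fL by (simp_all add: fUD ennreal_mult_less_top)
  have fP': "(\<integral>\<^sup>+y. f y \<partial>P') < \<infinity>"
    using mono[OF leP] fP fUD_fin by (simp add: P_def le_less_trans[of _ "_ + _"])
  have fN': "(\<integral>\<^sup>+y. f y \<partial>N') < \<infinity>"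
    using mono[OF leN] fN fUD_fin by (simp add: N_def le_less_trans[of _ "_ + _"])
  have fX: "(\<integral>y. f y \<partial>X) = enn2real (\<integral>\<^sup>+y. f y \<partial>X)" if "sets X = sets borel" for X :: "'a measure"
    using f that measurable_cong_sets[OF that refl] by (intro enn2real_nn_integral_nonneg) auto
  have "enn2real (\<integral>\<^sup>+y. f y \<partial>P') + enn2real (\<integral>\<^sup>+y. f y \<partial>N) + enn2real (\<integral>\<^sup>+y. f y \<partial>U) =
      enn2real (\<integral>\<^sup>+y. f y \<partial>N') + enn2real (\<integral>\<^sup>+y. f y \<partial>P) + enn2real (\<integral>\<^sup>+y. f y \<partial>D)"
    using arg_cong[OF *, of enn2real] fP' fN' fP fN fUD_fin
    by (simp add: P_def[symmetric] N_def[symmetric] enn2real_plus)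
  moreover have "enn2real (\<integral>\<^sup>+y. f y \<partial>U) - enn2real (\<integral>\<^sup>+y. f y \<partial>D) = c * (\<integral>y. f y \<partial>lborel)"
    by (simp add: fUD fX enn2real_mult max_def)
  ultimately show ?thesis
    unfolding signed_integral_def \<mu>'_def[symmetric] P_def[symmetric] N_def[symmetric]
      P'_def[symmetric] N'_def[symmetric]
    by (simp add: fX)
qed

text \<open>
  The total variation of \<open>\<nu>\<close> dominates the positive and negative variations of its real and
  imaginary parts, so that its finiteness hypotheses serve all four.
\<close>

lemma complex_measure_integral_minus_lebesgue:
  fixes \<nu> :: "'a::euclidean_space set \<Rightarrow> complex" and f :: "'a \<Rightarrow> real"
  assumes m: "locally_finite_complex_measure \<nu>"
    and fin: "\<And>E. E \<in> bounded_borel \<Longrightarrow> emeasure (total_variation \<nu>) E < \<infinity>"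
    and f: "f \<in> borel_measurable borel" "\<And>y. 0 \<le> f y"
    and fT: "(\<integral>\<^sup>+y. f y \<partial>total_variation \<nu>) < \<infinity>"
    and fL: "(\<integral>\<^sup>+y. f y \<partial>lborel) < \<infinity>"
  shows "complex_measure_integral (minus_lebesgue \<nu> l) f =
    complex_measure_integral \<nu> f - l * complex_of_real (\<integral>y. f y \<partial>lborel)"
proof -
  have fm: "(\<lambda>y. ennreal (f y)) \<in> borel_measurable borel" using f by measurable
  have le: "emeasure (positive_variation \<mu>) E \<le> emeasure (total_variation \<nu>) E"
    if \<mu>: "locally_finite_signed_measure \<mu>" "\<And>F. \<mu> F \<le> norm (\<nu> F)" and E: "E \<in> bounded_borel" for \<mu> E
    using E by (intro positive_variation_le[OF \<mu>(1)] order_trans[OF ennreal_leI[OF \<mu>(2)] norm_le_total_variation[OF m]]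
        bounded_borel_sets)
  have int: "(\<integral>\<^sup>+y. f y \<partial>positive_variation \<mu>) < \<infinity>"
    if \<mu>: "locally_finite_signed_measure \<mu>" "\<And>F. \<mu> F \<le> norm (\<nu> F)" for \<mu>
    using nn_integral_sum_mono_of_bounded_borel[of "{0::nat}" "\<lambda>_. positive_variation \<mu>" "{0::nat}" "\<lambda>_. total_variation \<nu>", OF _ _ _ fm]
      le[OF \<mu>] fT by (simp add: le_less_trans)
  have part: "signed_integral (\<lambda>E. \<mu> E - c * measure lborel E) f =
      signed_integral \<mu> f - c * (\<integral>y. f y \<partial>lborel)"
    if \<mu>: "locally_finite_signed_measure \<mu>" "\<And>F. \<bar>\<mu> F\<bar> \<le> norm (\<nu> F)" for \<mu> c
  proof (rule signed_integral_minus_lebesgue[OF \<mu>(1) _ f _ _ fL])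
    have *: "\<mu> F \<le> norm (\<nu> F)" "- \<mu> F \<le> norm (\<nu> F)" for F using \<mu>(2)[of F] by auto
    show "emeasure (positive_variation \<mu>) E < \<infinity>" if "E \<in> bounded_borel" for E
      using le[OF \<mu>(1) *(1) that] fin[OF that] by (rule le_less_trans)
    show "(\<integral>\<^sup>+y. f y \<partial>positive_variation \<mu>) < \<infinity>" by (rule int[OF \<mu>(1) *(1)])
    show "(\<integral>\<^sup>+y. f y \<partial>positive_variation (\<lambda>E. - \<mu> E)) < \<infinity>"
      by (rule int[OF signed_uminus[OF \<mu>(1)] *(2)])
  qed
  show ?thesis
    using m part[of "\<lambda>E. Re (\<nu> E)" "Re l"] part[of "\<lambda>E. Im (\<nu> E)" "Im l"]
    by (simp add: complex_measure_integral_def minus_lebesgue_def locally_finite_complex_measure_def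
        complex_eq_iff abs_Re_le_cmod abs_Im_le_cmod)
qed

lemma Phi_pos: "0 < Phi y"
proof -
  have "exp 1 + norm y > (1::real)"
    using one_less_exp_iff[of "1::real"] norm_ge_zero[of y] by linarith
  then have "ln (exp 1 + norm y) > 0" by simp
  moreover have "1 + norm y > 0" using norm_ge_zero[of y] by linarith
  ultimately show ?thesis by (simp add: Phi_def)
qed

lemma Phi_measurable [measurable]: "Phi \<in> borel_measurable borel"
  unfolding Phi_def[abs_def] by measurable

text \<open>
  On a bounded set \<open>Phi\<close> is bounded below by a positive constant.
\<close>

lemma total_variation_finite_on_bounded:
  fixes \<nu> :: "'a::euclidean_space set \<Rightarrow> complex"
  assumes "\<nu> \<in> measures_Phi" and E: "E \<in> bounded_borel"
  shows "emeasure (total_variation \<nu>) E < \<infinity>"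
proof -
  obtain R where R: "\<And>y. y \<in> E \<Longrightarrow> norm y \<le> R" "R > 0"
    using E by (auto simp: bounded_borel_def bounded_pos)
  define c where "c = exp (- R\<^sup>2 / 2) / ((1 + R) powr (real DIM('a) / 2) * ln (exp 1 + R) powr (3 / 2))"
  have e1: "exp 1 > (1::real)" by simp
  have c: "c > 0"
  proof -
    have "ln (exp 1 + R) > 0" using R(2) e1 by (intro ln_gt_zero) linarith
    then show ?thesis using R(2) by (simp add: c_def)
  qed
  have le: "c \<le> Phi y" if "y \<in> E" for y
  proof -
    have y: "norm y \<le> R" "0 \<le> norm y" using R(1)[OF that] by auto
    have 1: "exp 1 + norm y > (1::real)" "exp 1 + norm y \<le> exp 1 + R" using y e1 by linarith+
    then have 2: "0 < ln (exp 1 + norm y)" "ln (exp 1 + norm y) \<le> ln (exp 1 + R)" by auto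
    have p: "(1 + norm y) powr (real DIM('a) / 2) * ln (exp 1 + norm y) powr (3 / 2) \<le>
      (1 + R) powr (real DIM('a) / 2) * ln (exp 1 + R) powr (3 / 2)"
      using y 2 by (intro mult_mono powr_mono2) auto
    have "0 < (1 + norm y) powr (real DIM('a) / 2) * ln (exp 1 + norm y) powr (3 / 2)"
      using y(2) 2(1) add_pos_nonneg[of 1 "norm y"] by (intro mult_pos_pos) auto
    with p y show ?thesis unfolding c_def Phi_def
      by (intro frac_le) (auto intro!: power_mono)
  qed
  have Es: "E \<in> sets (total_variation \<nu>)" using bounded_borel_sets[OF E] by simp
  have "ennreal c * emeasure (total_variation \<nu>) E = (\<integral>\<^sup>+y. ennreal c * indicator E y \<partial>total_variation \<nu>)"
    by (rule nn_integral_cmult_indicator[OF Es, symmetric])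
  also have "\<dots> \<le> (\<integral>\<^sup>+y. ennreal (Phi y) \<partial>total_variation \<nu>)"
    using le by (intro nn_integral_mono) (auto simp: ennreal_leI split: split_indicator)
  also have "\<dots> < \<infinity>" using assms by (simp add: measures_Phi_def)
  finally show ?thesis using c by (auto simp: ennreal_mult_less_top)
qed

section \<open>A pointwise bound for the Poisson-Hermite kernel\<close>

definition kernel_integrand :: "real \<Rightarrow> 'a::euclidean_space \<Rightarrow> 'a \<Rightarrow> real \<Rightarrow> real" where
  "kernel_integrand t x y s =
     exp (- t\<^sup>2 / kappa s) * (1 - s\<^sup>2) powr (real DIM('a) / 2 - 1) *
     exp (- (1 / 4) * ((norm (x - y))\<^sup>2 / s + s * (norm (x + y))\<^sup>2)) /
     (s powr (real DIM('a) / 2) * kappa s powr (3 / 2))"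

definition kernel_const :: "'a::euclidean_space itself \<Rightarrow> real" where
  "kernel_const _ = 8 * (4 * pi) powr (- (real DIM('a) + 1) / 2)"

lemma kernel_const_pos: "0 < kernel_const TYPE('a::euclidean_space)"
  by (simp add: kernel_const_def)

lemma poisson_hermite_kernel_eq:
  fixes x y :: "'a::euclidean_space"
  shows "poisson_hermite_kernel t x y =
    kernel_const TYPE('a) * t * (LINT s:{0<..<1}|lborel. kernel_integrand t x y s)"
  by (simp add: poisson_hermite_kernel_def kernel_integrand_def kernel_const_def)

lemma kappa_measurable [measurable]: "kappa \<in> borel_measurable borel"
  unfolding kappa_def[abs_def] by measurable

lemma kernel_integrand_measurable [measurable]:
  assumes [measurable]: "f \<in> borel_measurable M" "g \<in> borel_measurable M" "h \<in> borel_measurable M"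
  shows "(\<lambda>z. kernel_integrand t (f z) (g z) (h z :: real)) \<in> borel_measurable M"
  unfolding kernel_integrand_def by measurable

lemma kernel_integrand_nonneg: "0 \<le> s \<Longrightarrow> 0 \<le> kernel_integrand t x y s"
  by (simp add: kernel_integrand_def)

lemma kappa_eq:
  assumes "0 < s" "s < 1"
  shows "kappa s = 2 * (ln (1 + s) - ln (1 - s))"
  using assms by (simp add: kappa_def ln_div)

lemma kappa_lower:
  assumes "0 < s" "s < 1"
  shows "2 * s \<le> kappa s" "- ln (1 - s) \<le> kappa s" "0 < kappa s"
proof -
  have 1: "ln (1 - s) \<le> - s" using ln_le_minus_one[of "1 - s"] assms by simp
  have 2: "0 \<le> ln (1 + s)" using assms by simp
  show "2 * s \<le> kappa s" unfolding kappa_eq[OF assms] using 1 2 by argo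
  then show "0 < kappa s" using assms by linarith
  show "- ln (1 - s) \<le> kappa s" unfolding kappa_eq[OF assms] using 1 2 assms by argo
qed

lemma kappa_upper:
  assumes "0 < s" "s \<le> 1/2"
  shows "kappa s \<le> 6 * s"
proof -
  have "ln (1 + s) \<le> s" using ln_le_minus_one[of "1 + s"] assms by simp
  moreover have "- ln (1 - s) \<le> 1 / (1 - s) - 1"
    using ln_le_minus_one[of "1 / (1 - s)"] assms by (simp add: ln_div)
  moreover have "1 / (1 - s) - 1 \<le> 2 * s"
    using assms mult_left_mono[of s "1/2" s] by (simp add: field_simps)
  ultimately show ?thesis using assms by (simp add: kappa_eq)
qed

text \<open>
  By Cauchy-Schwarz the exponent is smallest when \<open>x\<close> is a nonnegative multiple of \<open>y\<close>; then the
  claim, multiplied by \<open>4 s\<close>, is the positivity of a quadratic form in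
  \<open>(1 - s) \<bar>y\<bar>\<close> and \<open>\<bar>x\<bar>\<close>, whose determinant is nonnegative on \<open>(0, 1)\<close>.
\<close>

lemma mehler_exponent_lower:
  fixes x y :: "'a::euclidean_space"
  assumes s: "0 < s" "s < 1"
  shows "(norm y)\<^sup>2 / 2 + ((1 - s) * norm y)\<^sup>2 / 16 - 8 * (norm x)\<^sup>2 \<le>
    (1 / 4) * ((norm (x - y))\<^sup>2 / s + s * (norm (x + y))\<^sup>2)"
proof -
  define r X where "r = norm y" and "X = norm x"
  let ?p = "(1 - s) * r" and ?e = "1 - s / 4" and ?D = "1 + s\<^sup>2 + 32 * s"
  have rX: "r \<ge> 0" "X \<ge> 0" by (auto simp: r_def X_def)
  have minus: "(norm (x - y))\<^sup>2 = X\<^sup>2 + r\<^sup>2 - 2 * (x \<bullet> y)"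
    by (simp add: X_def r_def power2_norm_eq_inner inner_diff inner_commute algebra_simps)
  have plus: "(norm (x + y))\<^sup>2 = X\<^sup>2 + r\<^sup>2 + 2 * (x \<bullet> y)"
    by (simp add: X_def r_def power2_norm_eq_inner inner_add inner_commute algebra_simps)
  have cs: "x \<bullet> y \<le> X * r" unfolding X_def r_def by (rule norm_cauchy_schwarz)
  have s2: "s\<^sup>2 \<le> s" using s by (simp add: power2_eq_square)
  have s3: "s ^ 3 \<le> s" using s power_decreasing[of 1 3 s] by simp
  have "?D * ?e - (1 + s)\<^sup>2 = 119 / 4 * s - 8 * s\<^sup>2 - s ^ 3 / 4"
    by (simp add: algebra_simps power2_eq_square power3_eq_cube)
  also have "\<dots> \<ge> 0" using s2 s3 s by linarith
  finally have det: "0 \<le> ?D * ?e - (1 + s)\<^sup>2" .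
  have "?e * (?e * ?p\<^sup>2 - 2 * (1 + s) * ?p * X + ?D * X\<^sup>2) =
      (?e * ?p - (1 + s) * X)\<^sup>2 + (?D * ?e - (1 + s)\<^sup>2) * X\<^sup>2"
    by (simp add: algebra_simps power2_eq_square add_divide_distrib diff_divide_distrib)
  also have "\<dots> \<ge> 0" using det by (intro add_nonneg_nonneg mult_nonneg_nonneg) auto
  finally have form: "0 \<le> ?e * ?p\<^sup>2 - 2 * (1 + s) * ?p * X + ?D * X\<^sup>2"
    using s by (simp add: zero_le_mult_iff)
  have "4 * s * (r\<^sup>2 / 2 + ?p\<^sup>2 / 16 - 8 * X\<^sup>2) =
      (1 + s\<^sup>2) * (X\<^sup>2 + r\<^sup>2) - 2 * (1 - s\<^sup>2) * (X * r) -
      (?e * ?p\<^sup>2 - 2 * (1 + s) * ?p * X + ?D * X\<^sup>2)"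
    by (simp add: algebra_simps power2_eq_square add_divide_distrib diff_divide_distrib)
  also have "\<dots> \<le> (1 + s\<^sup>2) * (X\<^sup>2 + r\<^sup>2) - 2 * (1 - s\<^sup>2) * (x \<bullet> y)"
  proof -
    have "s\<^sup>2 \<le> 1" using s2 s by linarith
    then have "(1 - s\<^sup>2) * (x \<bullet> y) \<le> (1 - s\<^sup>2) * (X * r)"
      using cs by (intro mult_left_mono) auto
    then show ?thesis using form by linarith
  qed
  also have "\<dots> = 4 * s * ((1 / 4) * ((norm (x - y))\<^sup>2 / s + s * (norm (x + y))\<^sup>2))"
    unfolding minus plus using s by (simp add: field_simps power2_eq_square)
  finally show ?thesis unfolding r_def[symmetric] X_def[symmetric] using s by simp
qed

text \<open>
  With \<open>v = \<delta> (1 + r)\<close> one has \<open>ln (1 + r) = ln v - ln \<delta>\<close>: either \<open>\<delta>\<close> is so small that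
  \<open>- ln \<delta>\<close> is comparable with \<open>ln (1 + r)\<close>, or \<open>v\<close> is large.  This is how the logarithm
  in \<open>Phi\<close> arises.
\<close>

lemma ln_le_times_max_ln:
  fixes r \<delta> :: real
  assumes "0 \<le> r" "0 < \<delta>"
  shows "ln (exp 1 + r) \<le> (1 + \<delta> * (1 + r)) * max 1 (- ln \<delta>)"
proof -
  let ?v = "\<delta> * (1 + r)" and ?L = "max 1 (- ln \<delta>)"
  have "ln (exp 1 + r) \<le> ln (exp 1 * (1 + r))"
  proof -
    have "exp 1 + r \<le> exp 1 * (1 + r)"
      using assms mult_right_mono[of 1 "exp 1" r] by (simp add: algebra_simps)
    moreover have "0 < exp 1 + r" using assms by (simp add: add_pos_nonneg)
    ultimately show ?thesis by simp
  qed
  also have "\<dots> = 1 + ln (1 + r)" using assms by (simp add: ln_mult)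
  also have "ln (1 + r) = ln ?v - ln \<delta>" using assms by (simp add: ln_mult)
  also have "ln ?v \<le> ?v - 1" using assms by (intro ln_le_minus_one) (simp add: add_pos_nonneg)
  also have "1 + (?v - 1 - ln \<delta>) \<le> ?v * 1 + ?L" by simp
  also have "\<dots> \<le> ?v * ?L + ?L" using assms by (intro add_right_mono mult_left_mono) auto
  finally show ?thesis by (simp add: algebra_simps)
qed

lemma powr_log_factor_le:
  fixes r \<delta> :: real
  assumes "0 \<le> r" "0 < \<delta>"
  shows "1 / max 1 (- ln \<delta>) powr (3 / 2) \<le> (1 + \<delta> * (1 + r))\<^sup>2 / ln (exp 1 + r) powr (3 / 2)"
proof -
  let ?v = "\<delta> * (1 + r)" and ?L = "max 1 (- ln \<delta>)"
  have e: "exp 1 + r > (1::real)" using assms(1) one_less_exp_iff[of "1::real"] by linarith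
  then have l: "ln (exp 1 + r) > 0" by simp
  have v: "?v \<ge> 0" using assms by simp
  have "ln (exp 1 + r) powr (3 / 2) \<le> ((1 + ?v) * ?L) powr (3 / 2)"
    using l ln_le_times_max_ln[OF assms] by (intro powr_mono2) auto
  also have "\<dots> = (1 + ?v) powr (3 / 2) * ?L powr (3 / 2)"
    by (rule powr_mult)
  also have "(1 + ?v) powr (3 / 2) \<le> (1 + ?v) powr 2" using v by (intro powr_mono) auto
  also have "(1 + ?v) powr 2 = (1 + ?v)\<^sup>2" using v by (simp add: powr_numeral)
  finally have "ln (exp 1 + r) powr (3 / 2) \<le> (1 + ?v)\<^sup>2 * ?L powr (3 / 2)"
    by (simp add: mult_right_mono)
  then show ?thesis using l by (simp add: field_simps)
qed

lemma power_div_fact_le_exp: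
  fixes z :: real
  assumes "0 \<le> z"
  shows "z ^ n / fact n \<le> exp z"
proof -
  have "(\<Sum>k\<in>{n}. z ^ k /\<^sub>R fact k) \<le> (\<Sum>k. z ^ k /\<^sub>R fact k)"
    using assms by (intro sum_le_suminf summable_exp_generic) auto
  then show ?thesis by (simp add: exp_def field_simps)
qed

text \<open>
  The first summand bounds the kernel weight for \<open>s \<le> 1 / 2\<close>, where \<open>6\<close> comes from
  \<open>kappa s \<le> 6 s\<close>; the second bounds it for \<open>s > 1 / 2\<close>.
\<close>

definition weight_bound :: "nat \<Rightarrow> real \<Rightarrow> real" where
  "weight_bound n t = fact (n + 3) * (6 / t\<^sup>2) ^ (n + 3) + 2 ^ n"

lemma weight_bound_nonneg: "0 \<le> weight_bound n t"
  by (simp add: weight_bound_def)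

text \<open>
  Near \<open>s = 0\<close> the factor \<open>exp (- t\<^sup>2 / kappa s)\<close> beats every power of \<open>s\<close>; near
  \<open>s = 1\<close> only the logarithmic growth of \<open>kappa\<close> is left.
\<close>

lemma kernel_weight_le:
  fixes t s :: real
  assumes t: "0 < t" and s: "0 < s" "s < 1"
  shows "exp (- t\<^sup>2 / kappa s) / (s powr (real n / 2) * kappa s powr (3 / 2)) \<le>
    weight_bound n t / max 1 (- ln (1 - s)) powr (3 / 2)"
proof (cases "s \<le> 1 / 2")
  case True
  note k = kappa_lower[OF s] and ku = kappa_upper[OF s(1) True]
  let ?m = "n + 3"
  have "ln (1/2) \<le> ln (1 - s)" using True s by simp
  moreover have "ln (1/2::real) \<ge> -1" using ln_le_minus_one[of "2::real"] by (simp add: ln_div)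
  ultimately have L: "max 1 (- ln (1 - s)) = 1" by linarith
  define z where "z = t\<^sup>2 / (6 * s)"
  have z: "z > 0" using t s by (simp add: z_def)
  have "exp (- t\<^sup>2 / kappa s) \<le> exp (- z)"
    unfolding z_def using t s k ku by (simp add: frac_le)
  also have "exp (- z) \<le> fact ?m / z ^ ?m"
    using power_div_fact_le_exp[of z ?m] z by (simp add: exp_minus field_simps)
  also have "fact ?m / z ^ ?m = fact ?m * (6 / t\<^sup>2) ^ ?m * s ^ ?m"
    by (simp add: z_def field_simps power_divide power_mult_distrib)
  finally have e: "exp (- t\<^sup>2 / kappa s) \<le> fact ?m * (6 / t\<^sup>2) ^ ?m * s ^ ?m" .
  have "s ^ ?m = s powr real ?m" using s by (intro powr_realpow[symmetric])
  also have "\<dots> \<le> s powr (real n / 2 + 3 / 2)" using s by (intro powr_mono') auto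
  also have "\<dots> = s powr (real n / 2) * s powr (3 / 2)" by (rule powr_add)
  also have "\<dots> \<le> s powr (real n / 2) * kappa s powr (3 / 2)"
    using s k by (intro mult_left_mono powr_mono2) auto
  finally have s_le: "s ^ ?m \<le> s powr (real n / 2) * kappa s powr (3 / 2)" .
  have "exp (- t\<^sup>2 / kappa s) \<le> fact ?m * (6 / t\<^sup>2) ^ ?m * (s powr (real n / 2) * kappa s powr (3 / 2))"
    using s_le by (intro order_trans[OF e] mult_left_mono) auto
  then have "exp (- t\<^sup>2 / kappa s) / (s powr (real n / 2) * kappa s powr (3 / 2)) \<le> fact ?m * (6 / t\<^sup>2) ^ ?m"
    using s k by (simp add: divide_le_eq)
  also have "\<dots> \<le> weight_bound n t" by (simp add: weight_bound_def)
  finally show ?thesis by (simp add: L)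
next
  case False
  note k = kappa_lower[OF s]
  let ?L = "max 1 (- ln (1 - s))"
  have L: "?L \<le> kappa s" using k False by auto
  have "(1/2) ^ n \<le> s powr (real n / 2)"
  proof -
    have "(1/2::real) ^ n = (1/2) powr real n" by (simp add: powr_realpow)
    also have "\<dots> \<le> (1/2) powr (real n / 2)" by (intro powr_mono') auto
    also have "\<dots> \<le> s powr (real n / 2)" using False by (intro powr_mono2) auto
    finally show ?thesis .
  qed
  moreover have "?L powr (3 / 2) \<le> kappa s powr (3 / 2)" using L by (intro powr_mono2) auto
  ultimately have "(1/2) ^ n * ?L powr (3 / 2) \<le> s powr (real n / 2) * kappa s powr (3 / 2)"
    by (intro mult_mono) auto
  moreover have "exp (- t\<^sup>2 / kappa s) \<le> 1" using k by simp
  ultimately have "exp (- t\<^sup>2 / kappa s) / (s powr (real n / 2) * kappa s powr (3 / 2)) \<le>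
      1 / ((1/2) ^ n * ?L powr (3 / 2))"
    by (intro frac_le) auto
  also have "\<dots> = 2 ^ n / ?L powr (3 / 2)" by (simp add: power_divide)
  also have "\<dots> \<le> weight_bound n t / ?L powr (3 / 2)"
    by (intro divide_right_mono) (auto simp: weight_bound_def)
  finally show ?thesis .
qed

text \<open>
  Here \<open>\<delta> = 1 - s\<close>, \<open>p = \<delta> \<bar>y\<bar>\<close> and \<open>v = \<delta> (1 + \<bar>y\<bar>) \<le> p + 1\<close>.  The polynomial loss \<open>(1 + v)\<^sup>2\<close> from
  the logarithm is absorbed by the Gaussian factor \<open>exp (- p\<^sup>2 / 16)\<close>, of which only \<open>exp (- v)\<close>
  is kept in order to arrive at a Gamma integral.
\<close>

lemma kernel_integrand_le:
  fixes x y :: "'a::euclidean_space"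
  assumes t: "0 < t" and s: "0 < s" "s < 1"
  shows "kernel_integrand t x y s \<le>
    weight_bound DIM('a) t * 2 ^ DIM('a) * exp (8 * (norm x)\<^sup>2 + 39) *
    (exp (- (norm y)\<^sup>2 / 2) / ln (exp 1 + norm y) powr (3 / 2)) *
    ((1 - s) powr (real DIM('a) / 2 - 1) * exp (- ((1 - s) * (1 + norm y))))"
proof -
  let ?n = "DIM('a)" and ?\<delta> = "1 - s" and ?r = "norm y" and ?L = "max 1 (- ln (1 - s))"
  let ?v = "?\<delta> * (1 + ?r)" and ?p = "?\<delta> * ?r"
  let ?l = "ln (exp 1 + ?r) powr (3 / 2)"
  have \<delta>: "?\<delta> > 0" using s by simp
  have a: "exp (- t\<^sup>2 / kappa s) / (s powr (real ?n / 2) * kappa s powr (3 / 2)) \<le>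
      weight_bound ?n t * ((1 + ?v)\<^sup>2 / ?l)"
    using kernel_weight_le[OF t s, of ?n]
      mult_left_mono[OF powr_log_factor_le[of ?r ?\<delta>, OF _ \<delta>] weight_bound_nonneg[of ?n t]] by simp
  have b: "(1 - s\<^sup>2) powr (real ?n / 2 - 1) \<le> 2 ^ ?n * ?\<delta> powr (real ?n / 2 - 1)"
  proof -
    have "(1 - s\<^sup>2) powr (real ?n / 2 - 1) = (1 + s) powr (real ?n / 2 - 1) * ?\<delta> powr (real ?n / 2 - 1)"
      using s by (subst powr_mult[symmetric]) (auto simp: power2_eq_square algebra_simps)
    also have "(1 + s) powr (real ?n / 2 - 1) \<le> (1 + s) powr real ?n"
      using s by (intro powr_mono) auto
    also have "\<dots> \<le> 2 powr real ?n" using s by (intro powr_mono2) auto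
    also have "\<dots> = 2 ^ ?n" by (simp add: powr_realpow)
    finally show ?thesis by (simp add: mult_right_mono)
  qed
  have c: "exp (- (1 / 4) * ((norm (x - y))\<^sup>2 / s + s * (norm (x + y))\<^sup>2)) \<le>
      exp (8 * (norm x)\<^sup>2) * exp (- ?r\<^sup>2 / 2) * exp (- ?p\<^sup>2 / 16)"
    unfolding exp_add[symmetric] exp_le_cancel_iff using mehler_exponent_lower[OF s, of y x] by linarith
  have d: "(1 + ?v)\<^sup>2 * exp (- ?p\<^sup>2 / 16) \<le> exp 39 * exp (- ?v)"
  proof -
    have v: "?v \<ge> 0" "?v \<le> ?p + 1" using s by (auto simp: distrib_left)
    have "(1 + ?v)\<^sup>2 \<le> (exp ?v)\<^sup>2" using v exp_ge_add_one_self[of ?v] by (intro power_mono) auto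
    also have "\<dots> = exp (2 * ?v)" by (simp add: exp_double)
    finally have "(1 + ?v)\<^sup>2 * exp (- ?p\<^sup>2 / 16) \<le> exp (2 * ?v) * exp (- ?p\<^sup>2 / 16)" by simp
    also have "\<dots> = exp (2 * ?v - ?p\<^sup>2 / 16)" by (simp flip: exp_add)
    also have "\<dots> \<le> exp (39 - ?v)"
    proof -
      \<comment> \<open>The maximum of \<open>3 p - p\<^sup>2 / 16\<close> is \<open>36\<close>, at \<open>p = 24\<close>.\<close>
      have "0 \<le> (?p - 24)\<^sup>2" by simp
      then have "3 * ?p - ?p\<^sup>2 / 16 \<le> 36" by (simp add: power2_diff)
      then show ?thesis using v by simp
    qed
    also have "\<dots> = exp 39 * exp (- ?v)" by (simp flip: exp_add)
    finally show ?thesis .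
  qed
  have "kernel_integrand t x y s =
      (exp (- t\<^sup>2 / kappa s) / (s powr (real ?n / 2) * kappa s powr (3 / 2))) *
      (1 - s\<^sup>2) powr (real ?n / 2 - 1) *
      exp (- (1 / 4) * ((norm (x - y))\<^sup>2 / s + s * (norm (x + y))\<^sup>2))"
    by (simp add: kernel_integrand_def)
  also have "\<dots> \<le> (weight_bound ?n t * ((1 + ?v)\<^sup>2 / ?l)) * (2 ^ ?n * ?\<delta> powr (real ?n / 2 - 1)) *
      (exp (8 * (norm x)\<^sup>2) * exp (- ?r\<^sup>2 / 2) * exp (- ?p\<^sup>2 / 16))"
    using s by (intro mult_mono a b c mult_nonneg_nonneg divide_nonneg_nonneg weight_bound_nonneg) auto
  also have "\<dots> = (weight_bound ?n t * 2 ^ ?n * exp (8 * (norm x)\<^sup>2) *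
      (exp (- ?r\<^sup>2 / 2) / ?l) * ?\<delta> powr (real ?n / 2 - 1)) * ((1 + ?v)\<^sup>2 * exp (- ?p\<^sup>2 / 16))"
    by simp
  also have "\<dots> \<le> (weight_bound ?n t * 2 ^ ?n * exp (8 * (norm x)\<^sup>2) *
      (exp (- ?r\<^sup>2 / 2) / ?l) * ?\<delta> powr (real ?n / 2 - 1)) * (exp 39 * exp (- ?v))"
    by (intro mult_left_mono d mult_nonneg_nonneg divide_nonneg_nonneg weight_bound_nonneg) auto
  also have "\<dots> = weight_bound ?n t * 2 ^ ?n * exp (8 * (norm x)\<^sup>2 + 39) *
    (exp (- ?r\<^sup>2 / 2) / ?l) * (?\<delta> powr (real ?n / 2 - 1) * exp (- ?v))"
    by (simp add: exp_add)
  finally show ?thesis .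
qed

lemma nn_integral_powr_exp_le_Gamma:
  fixes a \<rho> :: real
  assumes a: "0 < a" and \<rho>: "0 < \<rho>"
  shows "(\<integral>\<^sup>+s. ennreal (indicator {0<..<1} s * ((1 - s) powr (a - 1) * exp (- ((1 - s) * \<rho>)))) \<partial>lborel)
    \<le> ennreal (Gamma a / \<rho> powr a)"
proof -
  let ?f = "\<lambda>s. ennreal (indicator {0<..<1} s * ((1 - s) powr (a - 1) * exp (- ((1 - s) * \<rho>))))"
  have eq: "(\<integral>\<^sup>+s. ?f s \<partial>lborel) = ennreal \<bar>- 1 / \<rho>\<bar> * (\<integral>\<^sup>+v. ?f (1 + (- 1 / \<rho>) * v) \<partial>lborel)"
    using \<rho> by (intro nn_integral_real_affine) auto
  have "(\<integral>\<^sup>+v. ?f (1 + (- 1 / \<rho>) * v) \<partial>lborel) \<le>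
      (\<integral>\<^sup>+v. ennreal (1 / \<rho> powr (a - 1)) * ennreal (indicator {0..} v * v powr (a - 1) / exp v) \<partial>lborel)"
  proof (rule nn_integral_mono)
    fix v :: real
    show "?f (1 + (- 1 / \<rho>) * v) \<le>
      ennreal (1 / \<rho> powr (a - 1)) * ennreal (indicator {0..} v * v powr (a - 1) / exp v)"
    proof (cases "0 < v \<and> v < \<rho>")
      case True
      have "?f (1 + (- 1 / \<rho>) * v) = ennreal ((v / \<rho>) powr (a - 1) * exp (- v))"
        using True \<rho> by simp
      also have "(v / \<rho>) powr (a - 1) * exp (- v) = 1 / \<rho> powr (a - 1) * (v powr (a - 1) / exp v)"
        by (simp add: powr_divide exp_minus field_simps)
      also have "ennreal \<dots> = ennreal (1 / \<rho> powr (a - 1)) * ennreal (v powr (a - 1) / exp v)"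
        by (rule ennreal_mult) auto
      finally show ?thesis using True by simp
    next
      case False
      then have "1 + (- 1 / \<rho>) * v \<notin> {0<..<1}" using \<rho> by (auto simp: field_simps)
      then show ?thesis by simp
    qed
  qed
  also have "\<dots> = ennreal (1 / \<rho> powr (a - 1)) * ennreal (Gamma a)"
    unfolding Gamma_conv_nn_integral_real[OF a] by (rule nn_integral_cmult) measurable
  finally have "(\<integral>\<^sup>+v. ?f (1 + (- 1 / \<rho>) * v) \<partial>lborel) \<le>
      ennreal (1 / \<rho> powr (a - 1)) * ennreal (Gamma a)" .
  then have "(\<integral>\<^sup>+s. ?f s \<partial>lborel) \<le> ennreal \<bar>- 1 / \<rho>\<bar> * (ennreal (1 / \<rho> powr (a - 1)) * ennreal (Gamma a))"
    unfolding eq by (rule mult_left_mono) simp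
  also have "\<dots> = ennreal (1 / \<rho> * (1 / \<rho> powr (a - 1) * Gamma a))"
  proof -
    have nn: "0 \<le> 1 / \<rho> powr (a - 1)" "0 \<le> Gamma a" "0 \<le> 1 / \<rho>"
      using Gamma_real_pos[OF a] \<rho> by simp_all
    have "\<bar>- 1 / \<rho>\<bar> = 1 / \<rho>" using \<rho> by simp
    then show ?thesis
      unfolding ennreal_mult[OF nn(3) mult_nonneg_nonneg[OF nn(1,2)]] ennreal_mult[OF nn(1,2)] by simp
  qed
  also have "1 / \<rho> * (1 / \<rho> powr (a - 1) * Gamma a) = Gamma a / \<rho> powr a"
    using \<rho> by (simp add: powr_diff)
  finally show ?thesis .
qed

text \<open>
  The Gamma integral over \<open>\<delta>\<close> supplies the factor \<open>(1 + \<bar>y\<bar>) powr (- d / 2)\<close> of \<open>Phi\<close>.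
\<close>

lemma nn_integral_kernel_integrand_le:
  fixes x :: "'a::euclidean_space"
  assumes t: "0 < t"
  obtains C where "C \<ge> 0"
    "\<And>y :: 'a. (\<integral>\<^sup>+s. ennreal (indicator {0<..<1} s * kernel_integrand t x y s) \<partial>lborel) \<le> ennreal (C * Phi y)"
proof
  let ?n = "DIM('a)"
  define K where "K = weight_bound ?n t * 2 ^ ?n * exp (8 * (norm x)\<^sup>2 + 39)"
  have K: "K \<ge> 0" by (simp add: K_def weight_bound_nonneg)
  have G: "Gamma (real ?n / 2) > 0" by (intro Gamma_real_pos) simp
  show "K * Gamma (real ?n / 2) \<ge> 0" using K G by simp
  fix y :: 'a
  let ?\<rho> = "1 + norm y" and ?l = "ln (exp 1 + norm y) powr (3 / 2)"
  define B where "B = K * (exp (- (norm y)\<^sup>2 / 2) / ?l)"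
  have B: "B \<ge> 0" using K by (simp add: B_def)
  let ?g = "\<lambda>s. (1 - s) powr (real ?n / 2 - 1) * exp (- ((1 - s) * ?\<rho>))"
  have \<rho>: "?\<rho> > 0" using norm_ge_zero[of y] by linarith
  have "(\<integral>\<^sup>+s. ennreal (indicator {0<..<1} s * kernel_integrand t x y s) \<partial>lborel) \<le>
      (\<integral>\<^sup>+s. ennreal B * ennreal (indicator {0<..<1} s * ?g s) \<partial>lborel)"
  proof (rule nn_integral_mono)
    fix s :: real
    show "ennreal (indicator {0<..<1} s * kernel_integrand t x y s) \<le>
      ennreal B * ennreal (indicator {0<..<1} s * ?g s)"
      using kernel_integrand_le[OF t, of s x y] B
      by (auto simp: B_def K_def split: split_indicator simp flip: ennreal_mult intro!: ennreal_leI)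
  qed
  also have "\<dots> = ennreal B * (\<integral>\<^sup>+s. ennreal (indicator {0<..<1} s * ?g s) \<partial>lborel)"
    by (rule nn_integral_cmult) measurable
  also have "\<dots> \<le> ennreal B * ennreal (Gamma (real ?n / 2) / ?\<rho> powr (real ?n / 2))"
    using \<rho> by (intro mult_left_mono nn_integral_powr_exp_le_Gamma) auto
  also have "\<dots> = ennreal (K * Gamma (real ?n / 2) * Phi y)"
    using B G by (simp add: B_def Phi_def mult_ac flip: ennreal_mult)
  finally show "(\<integral>\<^sup>+s. ennreal (indicator {0<..<1} s * kernel_integrand t x y s) \<partial>lborel) \<le>
    ennreal (K * Gamma (real ?n / 2) * Phi y)" .
qed

section \<open>The Poisson-Hermite semigroup applied to the constant one\<close>

text \<open>
  The density, in the variable \<open>s = tanh \<tau>\<close>, of the one-sided stable law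
  \<open>t / \<surd>(4 \<pi>) exp (- t\<^sup>2 / (4 \<tau>)) \<tau> powr (- 3 / 2) d\<tau>\<close> that turns \<open>exp (- \<tau> L)\<close> into \<open>exp (- t \<surd>L)\<close>;
  the factor \<open>4 / (1 - s\<^sup>2)\<close> is the derivative of \<open>kappa\<close>.
\<close>

definition subordination_density :: "real \<Rightarrow> real \<Rightarrow> real" where
  "subordination_density t s = t / sqrt pi * exp (- t\<^sup>2 / kappa s) * (4 / (1 - s\<^sup>2)) / kappa s powr (3 / 2)"

text \<open>
  The kernel of \<open>exp (- \<tau> L)\<close>, and below the value of \<open>exp (- \<tau> L) 1\<close> at \<open>x\<close>, for \<open>s = tanh \<tau>\<close>.
\<close>

definition mehler :: "real \<Rightarrow> 'a::euclidean_space \<Rightarrow> 'a \<Rightarrow> real" where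
  "mehler s x y = sqrt ((1 - s\<^sup>2) / (4 * pi * s)) ^ DIM('a) *
     exp (- (1 / 4) * ((norm (x - y))\<^sup>2 / s + s * (norm (x + y))\<^sup>2))"

definition mehler_mass :: "real \<Rightarrow> 'a::euclidean_space \<Rightarrow> real" where
  "mehler_mass s x = sqrt ((1 - s\<^sup>2) / (1 + s\<^sup>2)) ^ DIM('a) * exp (- (s / (1 + s\<^sup>2)) * (norm x)\<^sup>2)"

lemma sqrt_power_eq_powr:
  assumes "0 < (z::real)"
  shows "sqrt z ^ n = z powr (real n / 2)"
proof -
  have "sqrt z ^ n = sqrt z powr real n" using assms by (simp add: powr_realpow)
  also have "\<dots> = z powr (real n / 2)"
    using assms by (simp add: powr_half_sqrt[symmetric] powr_powr)
  finally show ?thesis .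
qed

lemma one_minus_square_pos: "0 < s \<Longrightarrow> s < 1 \<Longrightarrow> 0 < 1 - (s::real)\<^sup>2"
  by (simp add: power_less_one_iff abs_square_less_1)

lemma kernel_integrand_eq:
  fixes x y :: "'a::euclidean_space"
  assumes s: "0 < s" "s < 1"
  shows "kernel_const TYPE('a) * t * kernel_integrand t x y s = subordination_density t s * mehler s x y"
proof -
  let ?n = "DIM('a)" and ?q = "1 - s\<^sup>2"
  note q = one_minus_square_pos[OF s]
  have c: "kernel_const TYPE('a) = 4 / (sqrt pi * (4 * pi) powr (real ?n / 2))"
  proof -
    have e: "- (real ?n + 1) / 2 = - (real ?n / 2 + 1 / 2)" by (simp add: field_simps)
    have "(4 * pi) powr (- (real ?n + 1) / 2) = 1 / ((4 * pi) powr (real ?n / 2) * sqrt (4 * pi))"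
      unfolding e powr_minus powr_add inverse_eq_divide by (simp only: powr_half_sqrt pi_ge_zero mult_nonneg_nonneg zero_le_numeral)
    then show ?thesis by (simp add: kernel_const_def real_sqrt_mult)
  qed
  have m: "sqrt (?q / (4 * pi * s)) ^ ?n = ?q powr (real ?n / 2) / ((4 * pi) powr (real ?n / 2) * s powr (real ?n / 2))"
    using s q by (simp add: sqrt_power_eq_powr powr_divide powr_mult)
  have p: "?q powr (real ?n / 2 - 1) = ?q powr (real ?n / 2) / ?q"
    using q by (simp add: powr_diff)
  show ?thesis
    unfolding kernel_integrand_def subordination_density_def mehler_def c m p by (simp add: mult_ac)
qed

lemma kappa_has_derivative:
  assumes "0 < s" "s < 1"
  shows "(kappa has_real_derivative 4 / (1 - s\<^sup>2)) (at s)"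
proof -
  note q = one_minus_square_pos[OF assms]
  have "((\<lambda>s. 2 * (ln (1 + s) - ln (1 - s))) has_real_derivative 4 / (1 - s\<^sup>2)) (at s)"
    using assms q by (auto intro!: derivative_eq_intros simp: field_simps power2_eq_square)
  then show ?thesis
  proof (rule has_field_derivative_transform_within_open)
    show "open {0<..<1::real}" by simp
  qed (use assms in \<open>auto simp: kappa_eq\<close>)
qed

lemma kappa_isCont: "0 < s \<Longrightarrow> s < 1 \<Longrightarrow> isCont kappa s"
  using kappa_has_derivative DERIV_isCont by blast

text \<open>
  The weight \<open>kappa' / (\<surd>kappa (1 + kappa))\<close>, an exact derivative, dominates, up to
  the factor \<open>t / \<surd>\<pi>\<close>, the subordination density once the latter has been multiplied by a factor of size \<open>min 1 kappa\<close>.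
\<close>

definition dominating_weight :: "real \<Rightarrow> real" where
  "dominating_weight s = 4 / (1 - s\<^sup>2) / (sqrt (kappa s) * (1 + kappa s))"

lemma dominating_weight_integral:
  "set_integrable lborel {0<..<1} dominating_weight"
  "(LINT s:{0<..<1}|lborel. dominating_weight s) = pi"
proof -
  let ?F = "\<lambda>s. 2 * arctan (sqrt (kappa s))"
  have 0: "((\<lambda>s. 2 * arctan (sqrt (2 * ln ((1 + s) / (1 - s))))) \<longlongrightarrow> 0) (at_right (0::real))"
    by real_asymp
  have 1: "((\<lambda>s. 2 * arctan (sqrt (2 * ln ((1 + s) / (1 - s))))) \<longlongrightarrow> pi) (at_left (1::real))"
  proof -
    have "filterlim (\<lambda>s. sqrt (2 * ln ((1 + s) / (1 - s)))) at_top (at_left (1::real))"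
      by real_asymp
    then have "((\<lambda>s. 2 * arctan (sqrt (2 * ln ((1 + s) / (1 - s))))) \<longlongrightarrow> 2 * (pi / 2)) (at_left (1::real))"
      by (intro tendsto_mult tendsto_const filterlim_compose[OF tendsto_arctan_at_top])
    then show ?thesis by simp
  qed
  have lim: "((?F \<circ> real_of_ereal) \<longlongrightarrow> 0) (at_right 0)" "((?F \<circ> real_of_ereal) \<longlongrightarrow> pi) (at_left 1)"
    using 0 1 unfolding zero_ereal_def one_ereal_def ereal_tendsto_simps by (simp_all add: kappa_def)
  have D: "DERIV ?F s :> dominating_weight s" if "0 < ereal s" "ereal s < 1" for s
  proof -
    have s: "0 < s" "s < 1" using that by auto
    note k = kappa_lower(3)[OF s] and q = one_minus_square_pos[OF s]
    show ?thesis
      unfolding dominating_weight_def using k q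
      by (auto intro!: derivative_eq_intros kappa_has_derivative s simp: field_simps)
  qed
  have C: "isCont dominating_weight s" if "0 < ereal s" "ereal s < 1" for s
  proof -
    have s: "0 < s" "s < 1" using that by auto
    note k = kappa_lower(3)[OF s] and q = one_minus_square_pos[OF s]
    show ?thesis
      unfolding dominating_weight_def using k q
      by (intro continuous_intros kappa_isCont s) auto
  qed
  have nn: "AE s in lborel. 0 < ereal s \<longrightarrow> ereal s < 1 \<longrightarrow> 0 \<le> dominating_weight s"
    using kappa_lower(3) one_minus_square_pos
    by (intro AE_I2) (auto simp: dominating_weight_def less_imp_le)
  note FTC = interval_integral_FTC_nonneg[OF _ D C nn lim]
  show "set_integrable lborel {0<..<1} dominating_weight"
    using FTC(1) by (simp add: zero_ereal_def one_ereal_def)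
  show "(LINT s:{0<..<1}|lborel. dominating_weight s) = pi"
    using FTC(2) by (simp add: zero_ereal_def one_ereal_def interval_integral_Ioo)
qed

lemma subordination_density_measurable [measurable]: "subordination_density t \<in> borel_measurable borel"
  unfolding subordination_density_def[abs_def] by measurable

lemma subordination_density_nonneg: "0 < t \<Longrightarrow> 0 < s \<Longrightarrow> s < 1 \<Longrightarrow> 0 \<le> subordination_density t s"
  using one_minus_square_pos[of s] by (simp add: subordination_density_def)

text \<open>
  This is used with \<open>a = 1\<close>, where the exponential supplies the decay for small \<open>kappa\<close>, and with
  \<open>a = 1 - mehler_mass s x\<close>, where \<open>a\<close> does and the exponential is discarded.
\<close>

lemma subordination_density_mult_le:
  assumes t: "0 < t" and s: "0 < s" "s < 1" and B: "0 \<le> B"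
    and le: "exp (- t\<^sup>2 / kappa s) * a \<le> B * (kappa s / (1 + kappa s))"
  shows "subordination_density t s * a \<le> t / sqrt pi * B * dominating_weight s"
proof -
  note k = kappa_lower(3)[OF s] and q = one_minus_square_pos[OF s]
  have k32: "kappa s powr (3 / 2) = kappa s * sqrt (kappa s)"
  proof -
    have "kappa s powr (3 / 2) = kappa s powr (1 + 1 / 2)" by simp
    also have "\<dots> = kappa s * sqrt (kappa s)" using k by (simp only: powr_add powr_half_sqrt) simp
    finally show ?thesis .
  qed
  have "subordination_density t s * a = t / sqrt pi * (4 / (1 - s\<^sup>2)) / kappa s powr (3 / 2) * (exp (- t\<^sup>2 / kappa s) * a)"
    by (simp add: subordination_density_def)
  also have "\<dots> \<le> t / sqrt pi * (4 / (1 - s\<^sup>2)) / kappa s powr (3 / 2) * (B * (kappa s / (1 + kappa s)))"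
    using t q by (intro mult_left_mono le) auto
  also have "\<dots> = t / sqrt pi * B * dominating_weight s"
    using k by (simp add: k32 dominating_weight_def mult_ac)
  finally show ?thesis .
qed

lemma integral_exp_minus_square_half_line:
  "(LBINT u=-\<infinity>..0. exp (- u\<^sup>2)) = sqrt pi / 2"
proof -
  have "(LBINT u=-\<infinity>..0. exp (- u\<^sup>2)) = (LBINT u=-0..\<infinity>. exp (- (- u)\<^sup>2 :: real))"
    by (subst interval_integral_reflect) simp
  also have "\<dots> = (LINT u:{0<..}|lborel. exp (- u\<^sup>2 :: real))"
    by (simp add: zero_ereal_def interval_integral_to_infinity_eq)
  also have "\<dots> = (\<integral>u. indicator {0..} u *\<^sub>R exp (- u\<^sup>2 :: real) \<partial>lborel)"
    unfolding set_lebesgue_integral_def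
    by (intro integral_cong_AE) (use AE_lborel_singleton[of "0::real"] in \<open>auto split: split_indicator elim!: eventually_mono\<close>)
  also have "\<dots> = sqrt pi / 2"
    using gaussian_moment_0 by (rule has_bochner_integral_integral_eq)
  finally show ?thesis .
qed

text \<open>
  The substitution \<open>u = - t / \<surd>kappa\<close> turns the weight into a Gaussian density.
\<close>

lemma subordination_density_integral:
  assumes t: "0 < t"
  shows "set_integrable lborel {0<..<1} (subordination_density t)"
    and "(LINT s:{0<..<1}|lborel. subordination_density t s) = 1"
proof -
  \<comment> \<open>From \<open>exp (- z) \<le> 1 / (1 + z)\<close> with \<open>z = t\<^sup>2 / kappa s\<close>.\<close>
  have mono: "exp (- t\<^sup>2 / kappa s) \<le> (1 + 1 / t\<^sup>2) * (kappa s / (1 + kappa s))" if s: "0 < s" "s < 1" for s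
  proof -
    note k = kappa_lower(3)[OF s]
    let ?z = "t\<^sup>2 / kappa s"
    have z: "?z > 0" using t k by simp
    have "exp (- ?z) * (1 + ?z) \<le> exp (- ?z) * exp ?z"
      using exp_ge_add_one_self[of ?z] by (intro mult_left_mono) auto
    then have "exp (- ?z) * (1 + ?z) \<le> 1" by (simp flip: exp_add)
    then have "exp (- ?z) \<le> 1 / (1 + ?z)" using z by (simp add: field_simps)
    also have "\<dots> \<le> (1 + 1 / t\<^sup>2) * (kappa s / (1 + kappa s))"
    proof -
      have "1 / (1 + ?z) = kappa s / (kappa s + t\<^sup>2)" using k by (simp add: field_simps)
      also have "\<dots> \<le> kappa s / ((1 + kappa s) / (1 + 1 / t\<^sup>2))"
      proof (rule divide_left_mono)
        have "1 + kappa s \<le> (kappa s + t\<^sup>2) * (1 + 1 / t\<^sup>2)"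
          using t k by (simp add: algebra_simps)
        then show "(1 + kappa s) / (1 + 1 / t\<^sup>2) \<le> kappa s + t\<^sup>2"
          using t by (subst divide_le_eq) (auto simp: add_pos_pos)
      qed (use k t in \<open>auto intro!: mult_pos_pos divide_pos_pos add_pos_pos add_pos_nonneg\<close>)
      also have "\<dots> = (1 + 1 / t\<^sup>2) * (kappa s / (1 + kappa s))" by simp
      finally show ?thesis .
    qed
    finally show ?thesis by simp
  qed
  have le: "subordination_density t s \<le> t / sqrt pi * (1 + 1 / t\<^sup>2) * dominating_weight s" if s: "0 < s" "s < 1" for s
    using subordination_density_mult_le[OF t s, of "1 + 1 / t\<^sup>2" 1] mono[OF s] by simp
  have "set_integrable lborel {0<..<1} (\<lambda>s. t / sqrt pi * (1 + 1 / t\<^sup>2) * dominating_weight s)"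
    using dominating_weight_integral(1) by (rule set_integrable_mult_right)
  then show int: "set_integrable lborel {0<..<1} (subordination_density t)"
    unfolding set_integrable_def
  proof (rule Bochner_Integration.integrable_bound)
    show "AE s in lborel. norm (indicat_real {0<..<1} s *\<^sub>R subordination_density t s) \<le>
      norm (indicat_real {0<..<1} s *\<^sub>R (t / sqrt pi * (1 + 1 / t\<^sup>2) * dominating_weight s))"
    proof (rule AE_I2)
      fix s
      show "norm (indicat_real {0<..<1} s *\<^sub>R subordination_density t s) \<le>
        norm (indicat_real {0<..<1} s *\<^sub>R (t / sqrt pi * (1 + 1 / t\<^sup>2) * dominating_weight s))"
      proof (cases "s \<in> {0<..<1}")
        case True
        then show ?thesis
          using order_trans[OF le[of s] abs_ge_self] subordination_density_nonneg[OF t, of s] by simp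
      qed simp
    qed
  qed measurable
  let ?f = "\<lambda>u. 2 / sqrt pi * exp (- u\<^sup>2)"
  let ?g = "\<lambda>s. - t / sqrt (kappa s)"
  let ?g' = "\<lambda>s. t / 2 * (4 / (1 - s\<^sup>2)) / kappa s powr (3 / 2)"
  have fg: "?f (?g s) * ?g' s = subordination_density t s" if "0 < s" "s < 1" for s
    using kappa_lower(3)[OF that] by (simp add: subordination_density_def power_divide mult_ac)
  have subst: "(LBINT u=-\<infinity>..0. ?f u) = (LBINT s=0..1. ?f (?g s) * ?g' s)"
  proof (rule interval_integral_substitution_nonneg(2))
    show "DERIV ?g s :> ?g' s" if "0 < ereal s" "ereal s < 1" for s
    proof -
      have s: "0 < s" "s < 1" using that by auto
      note k = kappa_lower(3)[OF s] and q = one_minus_square_pos[OF s]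
      have k32: "kappa s powr (3 / 2) = sqrt (kappa s) ^ 3"
        using k by (simp add: sqrt_power_eq_powr)
      define D where "D = 4 / (1 - s\<^sup>2)"
      have kD: "(kappa has_real_derivative D) (at s)"
        unfolding D_def by (rule kappa_has_derivative[OF s])
      have "DERIV ?g s :> t * (D * (inverse (sqrt (kappa s)) / 2)) / (sqrt (kappa s))\<^sup>2"
        using k by (auto intro!: derivative_eq_intros kD simp: power2_eq_square)
      also have "t * (D * (inverse (sqrt (kappa s)) / 2)) / (sqrt (kappa s))\<^sup>2 = ?g' s"
        unfolding k32 D_def[symmetric] using k by (simp add: field_simps power2_eq_square power3_eq_cube)
      finally show ?thesis .
    qed
    show "isCont ?g' s" if "0 < ereal s" "ereal s < 1" for s
    proof -
      have s: "0 < s" "s < 1" using that by auto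
      note k = kappa_lower(3)[OF s] and q = one_minus_square_pos[OF s]
      show ?thesis using k q by (intro continuous_intros kappa_isCont s) auto
    qed
    show "0 \<le> ?g' s" if "0 \<le> ereal s" "ereal s \<le> 1" for s
      using that t by (auto intro!: divide_nonneg_nonneg mult_nonneg_nonneg simp: power_le_one)
    have "filterlim (\<lambda>s. - t / sqrt (2 * ln ((1 + s) / (1 - s)))) at_bot (at_right (0::real))"
      using t by real_asymp
    then show "((ereal \<circ> ?g \<circ> real_of_ereal) \<longlongrightarrow> - \<infinity>) (at_right 0)"
      unfolding zero_ereal_def ereal_tendsto_simps by (simp add: kappa_def)
    have "((\<lambda>s. - t / sqrt (2 * ln ((1 + s) / (1 - s)))) \<longlongrightarrow> 0) (at_left (1::real))"
      using t by real_asymp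
    then show "((ereal \<circ> ?g \<circ> real_of_ereal) \<longlongrightarrow> 0) (at_left 1)"
      unfolding zero_ereal_def one_ereal_def ereal_tendsto_simps by (simp add: kappa_def)
    have "set_integrable lborel {0<..<1} (\<lambda>s. ?f (?g s) * ?g' s)"
    proof (rule set_integrable_cong[THEN iffD1, rotated -1])
      show "subordination_density t s = ?f (?g s) * ?g' s" if "s \<in> {0<..<1}" for s
        using that by (intro fg[symmetric]) auto
    qed (use int in simp_all)
    then show "set_integrable lborel (einterval 0 1) (\<lambda>s. ?f (?g s) * ?g' s)"
      by (simp add: zero_ereal_def one_ereal_def)
  qed (auto intro!: continuous_intros)
  moreover have "(LBINT s=0..1. ?f (?g s) * ?g' s) = (LINT s:{0<..<1}|lborel. subordination_density t s)"
  proof -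
    have "(LBINT s=0..1. h s) = (LINT s:{0<..<1}|lborel. h s)" for h :: "real \<Rightarrow> real"
      by (simp add: zero_ereal_def one_ereal_def interval_integral_Ioo)
    then show ?thesis
      by (simp only:) (rule set_lebesgue_integral_cong, simp, intro allI impI fg, auto)
  qed
  moreover have "(LBINT u=-\<infinity>..0. ?f u) = 1"
    unfolding interval_lebesgue_integral_mult_right integral_exp_minus_square_half_line by simp
  ultimately show "(LINT s:{0<..<1}|lborel. subordination_density t s) = 1" by simp
qed

lemma nn_integral_exp_minus_square:
  fixes a m :: real
  assumes a: "0 < a"
  shows "(\<integral>\<^sup>+v. ennreal (exp (- (a * (v - m)\<^sup>2))) \<partial>lborel) = ennreal (sqrt (pi / a))"
proof -
  let ?\<sigma> = "1 / sqrt (2 * a)"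
  have \<sigma>2: "?\<sigma>\<^sup>2 = 1 / (2 * a)" using a by (simp only: power_divide power_one real_sqrt_pow2)
  then have \<sigma>: "2 * ?\<sigma>\<^sup>2 = 1 / a" by simp
  have eq: "exp (- (a * (v - m)\<^sup>2)) = sqrt (pi / a) * normal_density m ?\<sigma> v" for v
  proof -
    have "2 * pi * ?\<sigma>\<^sup>2 = pi / a" unfolding \<sigma>2 by simp
    moreover have "- (v - m)\<^sup>2 / (2 * ?\<sigma>\<^sup>2) = - (a * (v - m)\<^sup>2)" unfolding \<sigma> by simp
    ultimately show ?thesis using a by (simp add: normal_density_def)
  qed
  have "(\<integral>\<^sup>+v. ennreal (normal_density m ?\<sigma> v) \<partial>lborel) = ennreal (\<integral>v. normal_density m ?\<sigma> v \<partial>lborel)"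
    using a by (intro nn_integral_eq_integral integrable_normal_density) auto
  also have "\<dots> = 1" using a by (subst integral_normal_density) auto
  finally have 1: "(\<integral>\<^sup>+v. ennreal (normal_density m ?\<sigma> v) \<partial>lborel) = 1" .
  have "(\<integral>\<^sup>+v. ennreal (exp (- (a * (v - m)\<^sup>2))) \<partial>lborel) =
      (\<integral>\<^sup>+v. ennreal (sqrt (pi / a)) * ennreal (normal_density m ?\<sigma> v) \<partial>lborel)"
    unfolding eq using a by (intro nn_integral_cong ennreal_mult) auto
  also have "\<dots> = ennreal (sqrt (pi / a)) * (\<integral>\<^sup>+v. ennreal (normal_density m ?\<sigma> v) \<partial>lborel)"
    by (rule nn_integral_cmult) measurable
  finally show ?thesis by (simp add: 1)
qed

lemma nn_integral_exp_minus_norm_square: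
  fixes z :: "'a::euclidean_space"
  assumes a: "0 < a"
  shows "(\<integral>\<^sup>+y. ennreal (exp (- (a * (norm (y - z))\<^sup>2))) \<partial>lborel) = ennreal (sqrt (pi / a) ^ DIM('a))"
proof -
  have "exp (- (a * (norm (y - z))\<^sup>2)) = (\<Prod>b\<in>Basis. exp (- (a * (y \<bullet> b - z \<bullet> b)\<^sup>2)))" for y
  proof -
    have "(norm (y - z))\<^sup>2 = (\<Sum>b\<in>Basis. (y \<bullet> b - z \<bullet> b)\<^sup>2)"
      unfolding power2_norm_eq_inner
      by (subst euclidean_inner) (simp add: inner_diff_left power2_eq_square)
    then show ?thesis
      by (simp add: exp_sum[symmetric] sum_distrib_left sum_negf)
  qed
  then have "(\<integral>\<^sup>+y. ennreal (exp (- (a * (norm (y - z))\<^sup>2))) \<partial>lborel) =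
      (\<integral>\<^sup>+y. (\<Prod>b\<in>Basis. ennreal (exp (- (a * (y \<bullet> b - z \<bullet> b)\<^sup>2)))) \<partial>lborel)"
    by (simp add: prod_ennreal)
  also have "\<dots> = (\<Prod>b\<in>Basis. \<integral>\<^sup>+v. ennreal (exp (- (a * (v - z \<bullet> b)\<^sup>2))) \<partial>lborel)"
    by (rule nn_integral_lborel_prod) auto
  also have "\<dots> = ennreal (sqrt (pi / a) ^ DIM('a))"
    using a by (simp add: nn_integral_exp_minus_square ennreal_power)
  finally show ?thesis .
qed

lemma nn_integral_mehler:
  fixes x :: "'a::euclidean_space"
  assumes s: "0 < s" "s < 1"
  shows "(\<integral>\<^sup>+y. ennreal (mehler s x y) \<partial>lborel) = ennreal (mehler_mass s x)"
proof -
  let ?a = "(1 + s\<^sup>2) / (4 * s)" and ?\<beta> = "(1 - s\<^sup>2) / (1 + s\<^sup>2)"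
  define A where "A = sqrt ((1 - s\<^sup>2) / (4 * pi * s)) ^ DIM('a) * exp (- (s / (1 + s\<^sup>2)) * (norm x)\<^sup>2)"
  have p: "0 < 1 + s\<^sup>2" by (simp add: add_pos_nonneg)
  note q = one_minus_square_pos[OF s]
  have a: "0 < ?a" using s p by simp
  have A: "0 \<le> A" using s q by (simp add: A_def)
  \<comment> \<open>Completing the square in \<open>y\<close>.\<close>
  have sq: "(1 / 4) * ((norm (x - y))\<^sup>2 / s + s * (norm (x + y))\<^sup>2) =
      ?a * (norm (y - ?\<beta> *\<^sub>R x))\<^sup>2 + s / (1 + s\<^sup>2) * (norm x)\<^sup>2" for y
  proof -
    define X Y Z where "X = x \<bullet> x" and "Y = y \<bullet> y" and "Z = x \<bullet> y"
    have "(norm (x - y))\<^sup>2 = X + Y - 2 * Z" "(norm (x + y))\<^sup>2 = X + Y + 2 * Z" "(norm x)\<^sup>2 = X"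
      unfolding power2_norm_eq_inner X_def Y_def Z_def
      by (simp_all add: inner_diff inner_add inner_commute)
    moreover have "(norm (y - b *\<^sub>R x))\<^sup>2 = Y - 2 * b * Z + b\<^sup>2 * X" for b
      unfolding power2_norm_eq_inner X_def Y_def Z_def
      by (simp add: inner_diff inner_commute power2_eq_square algebra_simps)
    moreover have "(1 / 4) * ((X + Y - 2 * Z) / s + s * (X + Y + 2 * Z)) =
      ?a * (Y - 2 * ?\<beta> * Z + ?\<beta>\<^sup>2 * X) + s / (1 + s\<^sup>2) * X"
    proof -
      define P Q where "P = 1 + s\<^sup>2" and "Q = 1 - s\<^sup>2"
      have PQ: "P\<^sup>2 = Q\<^sup>2 + 4 * s\<^sup>2" by (simp add: P_def Q_def power2_eq_square algebra_simps)
      have "P > 0" using p by (simp add: P_def)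
      have "(1 / 4) * ((X + Y - 2 * Z) / s + s * (X + Y + 2 * Z)) = (P * (X + Y) - 2 * Q * Z) / (4 * s)"
        using s by (simp add: P_def Q_def field_simps power2_eq_square)
      also have "P * X = (Q\<^sup>2 + 4 * s\<^sup>2) * X / P"
        unfolding PQ[symmetric] using \<open>P > 0\<close> by (simp add: power2_eq_square)
      then have "(P * (X + Y) - 2 * Q * Z) / (4 * s) = ((Q\<^sup>2 + 4 * s\<^sup>2) * X / P + P * Y - 2 * Q * Z) / (4 * s)"
        by (simp add: distrib_left)
      also have "\<dots> = P / (4 * s) * (Y - 2 * (Q / P) * Z + (Q / P)\<^sup>2 * X) + s / P * X"
        using s \<open>P > 0\<close> by (simp add: field_simps power2_eq_square)
      finally show ?thesis unfolding P_def Q_def .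
    qed
    ultimately show ?thesis by (simp only:)
  qed
  have "mehler s x y = A * exp (- (?a * (norm (y - ?\<beta> *\<^sub>R x))\<^sup>2))" for y
  proof -
    have "- (1 / 4) * ((norm (x - y))\<^sup>2 / s + s * (norm (x + y))\<^sup>2) =
        - (s / (1 + s\<^sup>2)) * (norm x)\<^sup>2 + - (?a * (norm (y - ?\<beta> *\<^sub>R x))\<^sup>2)"
      using sq[of y] by linarith
    then show ?thesis unfolding mehler_def A_def by (simp only: exp_add mult.assoc)
  qed
  then have "(\<integral>\<^sup>+y. ennreal (mehler s x y) \<partial>lborel) =
      (\<integral>\<^sup>+y. ennreal A * ennreal (exp (- (?a * (norm (y - ?\<beta> *\<^sub>R x))\<^sup>2))) \<partial>lborel)"
    using A by (simp add: ennreal_mult)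
  also have "\<dots> = ennreal A * (\<integral>\<^sup>+y. ennreal (exp (- (?a * (norm (y - ?\<beta> *\<^sub>R x))\<^sup>2))) \<partial>lborel)"
    by (rule nn_integral_cmult) measurable
  also have "\<dots> = ennreal A * ennreal (sqrt (pi / ?a) ^ DIM('a))"
    by (subst nn_integral_exp_minus_norm_square[OF a]) simp
  also have "\<dots> = ennreal (A * sqrt (pi / ?a) ^ DIM('a))"
    using A a by (intro ennreal_mult[symmetric] zero_le_power real_sqrt_ge_zero divide_nonneg_pos) auto
  also have "A * sqrt (pi / ?a) ^ DIM('a) = mehler_mass s x"
  proof -
    have "sqrt ((1 - s\<^sup>2) / (4 * pi * s)) ^ DIM('a) * sqrt (pi / ?a) ^ DIM('a) =
        sqrt ((1 - s\<^sup>2) / (4 * pi * s) * (pi / ?a)) ^ DIM('a)"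
      by (simp only: real_sqrt_mult power_mult_distrib)
    also have "(1 - s\<^sup>2) / (4 * pi * s) * (pi / ?a) = ?\<beta>"
      using s p by simp
    finally show ?thesis unfolding A_def mehler_mass_def by (simp only: mult_ac)
  qed
  finally show ?thesis .
qed

text \<open>
  Both factors of \<open>mehler_mass\<close> lie in \<open>[0, 1]\<close>, so their deficits add up; Bernoulli's inequality
  bounds that of the power and \<open>1 - z \<le> exp (- z)\<close> that of the exponential.
\<close>

lemma mehler_mass_bounds:
  fixes x :: "'a::euclidean_space"
  assumes s: "0 < s" "s < 1"
  shows "0 \<le> mehler_mass s x" "mehler_mass s x \<le> 1"
    and "1 - mehler_mass s x \<le> (2 * real DIM('a) + (norm x)\<^sup>2) * s"
proof -
  let ?\<beta> = "(1 - s\<^sup>2) / (1 + s\<^sup>2)" and ?n = "DIM('a)"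
  define u v where "u = sqrt ?\<beta> ^ ?n" and "v = exp (- (s / (1 + s\<^sup>2)) * (norm x)\<^sup>2)"
  note q = one_minus_square_pos[OF s]
  have p: "0 < 1 + s\<^sup>2" by (simp add: add_pos_nonneg)
  have \<beta>: "0 < ?\<beta>" "?\<beta> \<le> 1" using p q by auto
  have u: "0 \<le> u" "u \<le> 1" using \<beta> by (auto simp: u_def power_le_one)
  have v: "0 \<le> v" "v \<le> 1" using s p by (auto simp: v_def)
  have m: "mehler_mass s x = u * v" by (simp add: mehler_mass_def u_def v_def)
  show "0 \<le> mehler_mass s x" "mehler_mass s x \<le> 1" using u v by (auto simp: m mult_le_one)
  have "1 - real ?n * (2 * s) \<le> u"
  proof -
    have s2: "s\<^sup>2 \<le> s" using s by (simp add: power2_eq_square)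
    have "1 - ?\<beta> = 2 * s\<^sup>2 / (1 + s\<^sup>2)" using p by (simp add: field_simps)
    also have "\<dots> \<le> 2 * s\<^sup>2 / 1" using p by (intro divide_left_mono) auto
    also have "\<dots> \<le> 2 * s" using s2 by simp
    finally have "real ?n * (1 - ?\<beta>) \<le> real ?n * (2 * s)" by (intro mult_left_mono) auto
    moreover have "1 + real ?n * (?\<beta> - 1) \<le> (1 + (?\<beta> - 1)) ^ ?n"
      using \<beta> by (intro Bernoulli_inequality) auto
    moreover have "?\<beta> ^ ?n \<le> sqrt ?\<beta> ^ ?n"
    proof (rule power_mono)
      have "?\<beta> * ?\<beta> \<le> ?\<beta> * 1" using \<beta> by (intro mult_left_mono) auto
      then show "?\<beta> \<le> sqrt ?\<beta>" using \<beta> by (intro real_le_rsqrt) (simp add: power2_eq_square)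
    qed (use \<beta> in auto)
    ultimately show ?thesis by (simp add: u_def algebra_simps)
  qed
  moreover have "1 - s * (norm x)\<^sup>2 \<le> v"
  proof -
    have "s / (1 + s\<^sup>2) * (norm x)\<^sup>2 \<le> s / 1 * (norm x)\<^sup>2"
      using s p by (intro mult_right_mono divide_left_mono) auto
    moreover have "1 + - (s / (1 + s\<^sup>2)) * (norm x)\<^sup>2 \<le> v"
      unfolding v_def by (rule exp_ge_add_one_self)
    ultimately show ?thesis by simp
  qed
  moreover have "1 - u * v \<le> (1 - u) + (1 - v)"
  proof -
    have "0 \<le> (1 - u) * (1 - v)" using u v by simp
    then show ?thesis by (simp add: algebra_simps)
  qed
  ultimately show "1 - mehler_mass s x \<le> (2 * real DIM('a) + (norm x)\<^sup>2) * s"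
    unfolding m by (simp add: algebra_simps)
qed

lemma mehler_measurable [measurable]:
  assumes [measurable]: "f \<in> borel_measurable M" "g \<in> borel_measurable M" "h \<in> borel_measurable M"
  shows "(\<lambda>z. mehler (f z) (g z) (h z :: 'a::euclidean_space)) \<in> borel_measurable M"
  unfolding mehler_def by measurable

lemma mehler_mass_measurable [measurable]: "(\<lambda>s. mehler_mass s x) \<in> borel_measurable borel"
  unfolding mehler_mass_def by measurable

lemma poisson_hermite_kernel_measurable [measurable]:
  "poisson_hermite_kernel t x \<in> borel_measurable borel"
proof -
  have "(\<lambda>y. LINT s|lborel. indicat_real {0<..<1} s *\<^sub>R kernel_integrand t x y s) \<in> borel_measurable borel"
    by measurable
  then show ?thesis
    unfolding poisson_hermite_kernel_eq[abs_def] set_lebesgue_integral_def by measurable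
qed

lemma ennreal_poisson_hermite_kernel:
  fixes x y :: "'a::euclidean_space"
  assumes t: "0 < t"
  shows "ennreal (poisson_hermite_kernel t x y) = ennreal (kernel_const TYPE('a) * t) *
      (\<integral>\<^sup>+s. ennreal (indicator {0<..<1} s * kernel_integrand t x y s) \<partial>lborel)"
    and "0 \<le> poisson_hermite_kernel t x y"
proof -
  let ?h = "\<lambda>s. indicator {0<..<1} s * kernel_integrand t x y s"
  obtain C where C: "(\<integral>\<^sup>+s. ennreal (?h s) \<partial>lborel) \<le> ennreal (C * Phi y)"
    using nn_integral_kernel_integrand_le[OF t, of x] by metis
  have nn: "0 \<le> ?h s" for s
    using kernel_integrand_nonneg[of s t x y] by (auto split: split_indicator)
  have int: "integrable lborel ?h"
    using C nn by (intro integrableI_nonneg) (auto intro: le_less_trans)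
  have eq: "poisson_hermite_kernel t x y = kernel_const TYPE('a) * t * (\<integral>s. ?h s \<partial>lborel)"
    by (simp add: poisson_hermite_kernel_eq set_lebesgue_integral_def)
  have I: "0 \<le> (\<integral>s. ?h s \<partial>lborel)" using nn by (intro Bochner_Integration.integral_nonneg) auto
  have c: "0 \<le> kernel_const TYPE('a) * t" using t kernel_const_pos[where 'a='a] by simp
  show "0 \<le> poisson_hermite_kernel t x y" unfolding eq using c I by (rule mult_nonneg_nonneg)
  have "ennreal (\<integral>s. ?h s \<partial>lborel) = (\<integral>\<^sup>+s. ennreal (?h s) \<partial>lborel)"
    using int nn by (intro nn_integral_eq_integral[symmetric]) auto
  then show "ennreal (poisson_hermite_kernel t x y) = ennreal (kernel_const TYPE('a) * t) *
      (\<integral>\<^sup>+s. ennreal (?h s) \<partial>lborel)"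
    unfolding eq ennreal_mult[OF c I] by simp
qed

text \<open>
  This makes the kernel integrable against the total variation of every \<open>\<nu> \<in> measures_Phi\<close>.
\<close>

lemma poisson_hermite_kernel_le_Phi:
  fixes x :: "'a::euclidean_space"
  assumes t: "0 < t"
  obtains C where "C \<ge> 0" "\<And>y :: 'a. poisson_hermite_kernel t x y \<le> C * Phi y"
proof -
  obtain C where C: "C \<ge> 0" "\<And>y :: 'a. (\<integral>\<^sup>+s. ennreal (indicator {0<..<1} s * kernel_integrand t x y s) \<partial>lborel) \<le> ennreal (C * Phi y)"
    using nn_integral_kernel_integrand_le[OF t, of x] by metis
  have c: "0 \<le> kernel_const TYPE('a) * t" using t kernel_const_pos[where 'a='a] by simp
  show thesis
  proof
    show "0 \<le> kernel_const TYPE('a) * t * C" using c C(1) by simp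
    fix y :: 'a
    have CP: "0 \<le> C * Phi y" using C(1) Phi_pos[of y] by simp
    have "ennreal (poisson_hermite_kernel t x y) \<le> ennreal (kernel_const TYPE('a) * t) * ennreal (C * Phi y)"
      unfolding ennreal_poisson_hermite_kernel(1)[OF t] by (intro mult_left_mono C(2)) simp
    also have "\<dots> = ennreal (kernel_const TYPE('a) * t * (C * Phi y))"
      using c CP by (rule ennreal_mult[symmetric])
    finally show "poisson_hermite_kernel t x y \<le> kernel_const TYPE('a) * t * C * Phi y"
      using mult_nonneg_nonneg[OF c CP] by (subst (asm) ennreal_le_iff) (auto simp: mult.assoc)
  qed
qed

text \<open>
  Tonelli's theorem: the integral over \<open>y\<close> acts on the Mehler kernel alone.
\<close>

lemma nn_integral_poisson_hermite_kernel:
  fixes x :: "'a::euclidean_space"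
  assumes t: "0 < t"
  shows "(\<integral>\<^sup>+y. ennreal (poisson_hermite_kernel t x y) \<partial>lborel) =
    (\<integral>\<^sup>+s. ennreal (indicator {0<..<1} s * (subordination_density t s * mehler_mass s x)) \<partial>lborel)"
proof -
  have c: "0 \<le> kernel_const TYPE('a) * t" using t kernel_const_pos[where 'a='a] by simp
  have w: "0 \<le> indicator {0<..<1} s * subordination_density t s" for s
    using subordination_density_nonneg[OF t, of s] by (auto split: split_indicator)
  have "ennreal (poisson_hermite_kernel t x y) =
      (\<integral>\<^sup>+s. ennreal (indicator {0<..<1} s * subordination_density t s) * ennreal (mehler s x y) \<partial>lborel)" for y
  proof -
    have "ennreal (poisson_hermite_kernel t x y) =
        (\<integral>\<^sup>+s. ennreal (kernel_const TYPE('a) * t) * ennreal (indicator {0<..<1} s * kernel_integrand t x y s) \<partial>lborel)"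
      unfolding ennreal_poisson_hermite_kernel(1)[OF t] by (rule nn_integral_cmult[symmetric]) measurable
    also have "\<dots> = (\<integral>\<^sup>+s. ennreal (indicator {0<..<1} s * subordination_density t s) * ennreal (mehler s x y) \<partial>lborel)"
    proof (rule nn_integral_cong)
      fix s :: real
      show "ennreal (kernel_const TYPE('a) * t) * ennreal (indicator {0<..<1} s * kernel_integrand t x y s) =
        ennreal (indicator {0<..<1} s * subordination_density t s) * ennreal (mehler s x y)"
      proof (cases "s \<in> {0<..<1}")
        case True
        then have s: "0 < s" "s < 1" by auto
        have "ennreal (kernel_const TYPE('a) * t) * ennreal (kernel_integrand t x y s) =
            ennreal (kernel_const TYPE('a) * t * kernel_integrand t x y s)"
          using c s by (intro ennreal_mult[symmetric] kernel_integrand_nonneg) auto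
        also have "\<dots> = ennreal (subordination_density t s) * ennreal (mehler s x y)"
          unfolding kernel_integrand_eq[OF s] using subordination_density_nonneg[OF t s] by (rule ennreal_mult')
        finally show ?thesis using True by simp
      qed simp
    qed
    finally show ?thesis .
  qed
  then have "(\<integral>\<^sup>+y. ennreal (poisson_hermite_kernel t x y) \<partial>lborel) =
      (\<integral>\<^sup>+y. \<integral>\<^sup>+s. ennreal (indicator {0<..<1} s * subordination_density t s) * ennreal (mehler s x y) \<partial>lborel \<partial>lborel)"
    by simp
  also have "\<dots> = (\<integral>\<^sup>+s. \<integral>\<^sup>+y. ennreal (indicator {0<..<1} s * subordination_density t s) * ennreal (mehler s x y) \<partial>lborel \<partial>lborel)"
    by (rule lborel_pair.Fubini') measurable
  also have "\<dots> = (\<integral>\<^sup>+s. ennreal (indicator {0<..<1} s * (subordination_density t s * mehler_mass s x)) \<partial>lborel)"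
  proof (rule nn_integral_cong)
    fix s :: real
    have "(\<integral>\<^sup>+y. ennreal (indicator {0<..<1} s * subordination_density t s) * ennreal (mehler s x y) \<partial>lborel) =
        ennreal (indicator {0<..<1} s * subordination_density t s) * (\<integral>\<^sup>+y. ennreal (mehler s x y) \<partial>lborel)"
      by (rule nn_integral_cmult) measurable
    also have "\<dots> = ennreal (indicator {0<..<1} s * (subordination_density t s * mehler_mass s x))"
    proof (cases "s \<in> {0<..<1}")
      case True
      then have s: "0 < s" "s < 1" by auto
      show ?thesis using True
        by (simp add: nn_integral_mehler[OF s] ennreal_mult'[OF subordination_density_nonneg[OF t s]])
    qed simp
    finally show "(\<integral>\<^sup>+y. ennreal (indicator {0<..<1} s * subordination_density t s) * ennreal (mehler s x y) \<partial>lborel) =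
      ennreal (indicator {0<..<1} s * (subordination_density t s * mehler_mass s x))" .
  qed
  finally show ?thesis .
qed

text \<open>
  Since the subordination density has integral \<open>1\<close>, the difference is the average of
  \<open>1 - mehler_mass\<close>.  This is at most a constant times \<open>kappa / (1 + kappa)\<close>, and then the integrand
  is at most \<open>t\<close> times the dominating weight, whose integral is \<open>\<pi>\<close>.
\<close>

lemma poisson_hermite_one:
  fixes x :: "'a::euclidean_space"
  assumes t: "0 < t"
  shows "(\<integral>\<^sup>+y. ennreal (poisson_hermite_kernel t x y) \<partial>lborel) < \<infinity>"
    and "\<bar>(\<integral>y. poisson_hermite_kernel t x y \<partial>lborel) - 1\<bar> \<le>
      sqrt pi * (2 + 2 * real DIM('a) + (norm x)\<^sup>2) * t"
proof -
  let ?I = "{0<..<1::real}"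
  define B where "B = 2 + 2 * real DIM('a) + (norm x)\<^sup>2"
  have B: "2 \<le> B" by (simp add: B_def)
  have w: "set_integrable lborel ?I (subordination_density t)" by (rule subordination_density_integral(1)[OF t])
  have wm: "set_integrable lborel ?I (\<lambda>s. subordination_density t s * mehler_mass s x)"
  proof (rule set_integrable_bound[OF w])
    show "AE s in lborel. s \<in> ?I \<longrightarrow> norm (subordination_density t s * mehler_mass s x) \<le> norm (subordination_density t s)"
      using mehler_mass_bounds[of _ x] by (intro AE_I2) (auto simp: abs_mult intro!: mult_left_le)
  qed (simp add: set_borel_measurable_def)
  define p where "p = (LINT s:?I|lborel. subordination_density t s * mehler_mass s x)"
  have nn: "0 \<le> indicator ?I s * (subordination_density t s * mehler_mass s x)" for s
    using mehler_mass_bounds[of s x] subordination_density_nonneg[OF t, of s] by (auto split: split_indicator)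
  have p: "0 \<le> p"
    unfolding p_def set_lebesgue_integral_def using nn by (intro Bochner_Integration.integral_nonneg) simp
  have "(\<integral>\<^sup>+s. ennreal (indicator ?I s * (subordination_density t s * mehler_mass s x)) \<partial>lborel) = ennreal p"
    using wm nn unfolding p_def set_lebesgue_integral_def set_integrable_def
    by (simp add: nn_integral_eq_integral)
  then have total: "(\<integral>\<^sup>+y. ennreal (poisson_hermite_kernel t x y) \<partial>lborel) = ennreal p"
    using nn_integral_poisson_hermite_kernel[OF t, of x] by simp
  then show "(\<integral>\<^sup>+y. ennreal (poisson_hermite_kernel t x y) \<partial>lborel) < \<infinity>" by simp
  have K: "(\<integral>y. poisson_hermite_kernel t x y \<partial>lborel) = p"
    using total p ennreal_poisson_hermite_kernel(2)[OF t]
    by (subst enn2real_nn_integral_nonneg) auto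
  have diff: "1 - p = (LINT s:?I|lborel. subordination_density t s - subordination_density t s * mehler_mass s x)"
    unfolding p_def set_integral_diff(2)[OF w wm] subordination_density_integral(2)[OF t] ..
  have pt: "0 \<le> subordination_density t s - subordination_density t s * mehler_mass s x"
    "subordination_density t s - subordination_density t s * mehler_mass s x \<le> t / sqrt pi * B * dominating_weight s"
    if "s \<in> ?I" for s
  proof -
    have s: "0 < s" "s < 1" using that by auto
    note m = mehler_mass_bounds[OF s, of x] and k = kappa_lower[OF s]
    have eq: "subordination_density t s - subordination_density t s * mehler_mass s x = subordination_density t s * (1 - mehler_mass s x)"
      by (simp add: algebra_simps)
    show "0 \<le> subordination_density t s - subordination_density t s * mehler_mass s x"
      unfolding eq using m subordination_density_nonneg[OF t s] by simp
    have "1 - mehler_mass s x \<le> B * (kappa s / (1 + kappa s))"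
    proof (cases "kappa s \<le> 1")
      case True
      have "1 - mehler_mass s x \<le> B * s"
        using m(3) s by (simp add: B_def algebra_simps)
      also have "\<dots> \<le> B * (kappa s / 2)" using k B by (intro mult_left_mono) auto
      also have "\<dots> \<le> B * (kappa s / (1 + kappa s))"
        using True k B by (intro mult_left_mono divide_left_mono) auto
      finally show ?thesis .
    next
      case False
      then have "1 / 2 \<le> kappa s / (1 + kappa s)" by (simp add: field_simps)
      then have "2 * (1 / 2) \<le> B * (kappa s / (1 + kappa s))" using B by (intro mult_mono) auto
      then show ?thesis using m by simp
    qed
    moreover have "exp (- t\<^sup>2 / kappa s) * (1 - mehler_mass s x) \<le> 1 * (1 - mehler_mass s x)"
      using k m by (intro mult_right_mono) auto
    ultimately show "subordination_density t s - subordination_density t s * mehler_mass s x \<le> t / sqrt pi * B * dominating_weight s"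
      unfolding eq using B by (intro subordination_density_mult_le[OF t s]) auto
  qed
  have "0 \<le> 1 - p"
    unfolding diff set_lebesgue_integral_def using pt(1)
    by (intro Bochner_Integration.integral_nonneg) (simp split: split_indicator)
  moreover have "1 - p \<le> (LINT s:?I|lborel. t / sqrt pi * B * dominating_weight s)"
    unfolding diff using pt(2) w wm dominating_weight_integral(1)
    by (intro set_integral_mono set_integral_diff(1) set_integrable_mult_right) auto
  moreover have "(LINT s:?I|lborel. t / sqrt pi * B * dominating_weight s) = sqrt pi * B * t"
  proof -
    have "(LINT s:?I|lborel. t / sqrt pi * B * dominating_weight s) = t / sqrt pi * B * pi"
      unfolding set_integral_mult_right dominating_weight_integral(2) ..
    also have "\<dots> = (pi / sqrt pi) * B * t" by simp
    also have "pi / sqrt pi = sqrt pi" by (rule real_div_sqrt) simp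
    finally show ?thesis .
  qed
  ultimately show "\<bar>(\<integral>y. poisson_hermite_kernel t x y \<partial>lborel) - 1\<bar> \<le>
      sqrt pi * (2 + 2 * real DIM('a) + (norm x)\<^sup>2) * t"
    unfolding K B_def[symmetric] by simp
qed

section \<open>Linearity and the limit\<close>

lemma poisson_hermite_minus_lebesgue:
  fixes \<nu> :: "'a::euclidean_space set \<Rightarrow> complex" and x :: 'a
  assumes \<nu>: "\<nu> \<in> measures_Phi" and t: "0 < t"
  shows "poisson_hermite t (minus_lebesgue \<nu> l) x =
    poisson_hermite t \<nu> x - l * complex_of_real (\<integral>y. poisson_hermite_kernel t x y \<partial>lborel)"
  unfolding poisson_hermite_def
proof (rule complex_measure_integral_minus_lebesgue)
  show "locally_finite_complex_measure \<nu>" using \<nu> by (simp add: measures_Phi_def)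
  show "emeasure (total_variation \<nu>) E < \<infinity>" if "E \<in> bounded_borel" for E
    using \<nu> that by (rule total_variation_finite_on_bounded)
  show "poisson_hermite_kernel t x \<in> borel_measurable borel" by measurable
  show "0 \<le> poisson_hermite_kernel t x y" for y
    by (rule ennreal_poisson_hermite_kernel(2)[OF t])
  show "(\<integral>\<^sup>+y. ennreal (poisson_hermite_kernel t x y) \<partial>lborel) < \<infinity>"
    by (rule poisson_hermite_one(1)[OF t])
  obtain C where C: "C \<ge> 0" "\<And>y :: 'a. poisson_hermite_kernel t x y \<le> C * Phi y"
    using poisson_hermite_kernel_le_Phi[OF t, of x] by metis
  have Phi: "(\<lambda>y. ennreal (Phi y)) \<in> borel_measurable (total_variation \<nu>)"
    unfolding measurable_cong_sets[OF sets_total_variation refl] by measurable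
  have "(\<integral>\<^sup>+y. ennreal (poisson_hermite_kernel t x y) \<partial>total_variation \<nu>) \<le>
      (\<integral>\<^sup>+y. ennreal C * ennreal (Phi y) \<partial>total_variation \<nu>)"
    using C by (intro nn_integral_mono) (simp add: ennreal_mult'[symmetric] ennreal_leI)
  also have "\<dots> = ennreal C * (\<integral>\<^sup>+y. ennreal (Phi y) \<partial>total_variation \<nu>)"
    by (rule nn_integral_cmult[OF Phi])
  also have "\<dots> < \<infinity>" using \<nu> by (simp add: measures_Phi_def ennreal_mult_less_top)
  finally show "(\<integral>\<^sup>+y. ennreal (poisson_hermite_kernel t x y) \<partial>total_variation \<nu>) < \<infinity>" .
qed

theorem lemma2p4:
  fixes \<nu> :: "'a::euclidean_space set \<Rightarrow> complex" and l :: complex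
  assumes "\<nu> \<in> measures_Phi"
  shows "\<forall>x0 :: 'a.
    ((\<lambda>(t :: real, x :: 'a).
        (poisson_hermite t \<nu> x - l) - poisson_hermite t (minus_lebesgue \<nu> l) x) \<longlongrightarrow> 0)
      (at (0, x0) within {0<..} \<times> UNIV)"
proof
  fix x0 :: 'a
  let ?F = "at (0::real, x0) within {0<..} \<times> UNIV"
  let ?b = "\<lambda>z::real \<times> 'a. norm l * (sqrt pi * (2 + 2 * real DIM('a) + (norm (snd z))\<^sup>2) * fst z)"
  have bound: "norm ((poisson_hermite t \<nu> x - l) - poisson_hermite t (minus_lebesgue \<nu> l) x) \<le> ?b (t, x)"
    if t: "0 < t" for t :: real and x :: 'a
  proof -
    let ?p = "\<integral>y. poisson_hermite_kernel t x y \<partial>lborel"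
    have "(poisson_hermite t \<nu> x - l) - poisson_hermite t (minus_lebesgue \<nu> l) x =
        l * complex_of_real (?p - 1)"
      unfolding poisson_hermite_minus_lebesgue[OF assms t] by (simp add: algebra_simps)
    also have "norm \<dots> = norm l * \<bar>?p - 1\<bar>"
      unfolding norm_mult norm_of_real ..
    also have "\<dots> \<le> ?b (t, x)"
      unfolding fst_conv snd_conv by (intro mult_left_mono poisson_hermite_one(2)[OF t]) simp
    finally show ?thesis .
  qed
  have "(?b \<longlongrightarrow> ?b (0, x0)) ?F"
    by (intro tendsto_intros tendsto_fst tendsto_snd tendsto_ident_at)
  then have lim: "(?b \<longlongrightarrow> 0) ?F" by simp
  show "((\<lambda>(t, x). (poisson_hermite t \<nu> x - l) - poisson_hermite t (minus_lebesgue \<nu> l) x) \<longlongrightarrow> 0) ?F"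
  proof (rule Lim_null_comparison[OF _ lim])
    show "\<forall>\<^sub>F z in ?F. norm (case z of (t, x) \<Rightarrow>
        (poisson_hermite t \<nu> x - l) - poisson_hermite t (minus_lebesgue \<nu> l) x) \<le> ?b z"
      unfolding eventually_at_filter using bound by (intro always_eventually) auto
  qed
qed

end
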